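(* Let $n, \mathfrak{d} \in \mathbb{N}$ satisfy $\frac{n+3}{2} \leq \mathfrak{d} <n$ and $n \geq 5$. Then there is an uncountable collection $\mathfrak{C}$ of $\mathfrak{d}$-dimensional non-degenerate subspaces $\Gamma \subset \mathbb{R}^n$ such that for each $\Gamma \in \mathfrak{C}$ there is an associated symbol $m_{\Gamma}\in\mathcal{M}_\Gamma(\mathbb{R}^n)$ (i.e. adapted to $\Gamma$ in the Mikhlin-H\"ormander sense) for which the associated multilinear multiplier $T_{m_{\Gamma}}$ is unbounded, i.e. satisfies no $L^p$ estimates.
   Context: A $\mathfrak{d}$-dimensional subspace $\Gamma\subset\mathbb{R}^n$ is non-degenerate if $\tilde\Gamma:=\{(\xi_1,\dots,\xi_{n+1})\in\mathbb{R}^{n+1}:(\xi_1,\dots,\xi_n)\in\Gamma,\ \sum_{j=1}^{n+1}\xi_j=0\}$ is a graph over the variables $(\xi_{i_1},\dots,\xi_{i_{\mathfrak{d}}})$ for every $1\le i_1<\dots<i_{\mathfrak{d}}\le n+1$. $\mathcal{M}_\Gamma(\mathbb{R}^n)$ is the set of functions $m:\mathbb{R}^n\to\mathbb{R}$ such that for every multi-index $\vec\gamma\in(\mathbb{N}\cup\{0\})^n$ there is $C_{\vec\gamma}$ with $|\partial^{\vec\gamma}m(\vec\xi)|\le C_{\vec\gamma}\,\mathrm{dist}(\vec\xi,\Gamma)^{-|\vec\gamma|}$ (for $\vec\xi\notin\Gamma$). For $m\in L^\infty(\mathbb{R}^n)$, $T_m(f_1,\dots,f_n)(x)=\int_{\mathbb{R}^n}m(\vec\xi)\big[\prod_{j=1}^n\hat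 f_j(\xi_j)e^{2\pi i x\xi_j}\big]d\vec\xi$, defined a priori on $\mathcal{S}(\mathbb{R})^n$, with $\hat f(\xi)=\int_{\mathbb{R}} f(x)e^{-2\pi i x\xi}dx$. An $n$-linear operator $T$ defined a priori on $\mathcal{S}(\mathbb{R})^n$ "satisfies no $L^p$ estimates" if there is no $n$-tuple $(p_1,\dots,p_n)\in[1,\infty]^n$ for which there is a constant $C$ such that $\|T(\vec f)\|_p\le C\prod_{j=1}^n\|f_j\|_{p_j}$ for all $\vec f\in\mathcal{S}(\mathbb{R})^n$, where $\frac1p=\sum_{j=1}^n\frac1{p_j}$ (with $1/\infty=0$). *)

theory Defs
  imports "HOL-Analysis.Analysis" "HOL-Probability.Essential_Supremum"
begin

section \<open>Non-degenerate subspaces\<close>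

text \<open>
  The space \<open>\<real>\<^sup>n\<close> is \<^typ>\<open>real ^ 'n\<close>, and \<open>\<real>\<^sup>n\<^sup>+\<^sup>1\<close> is
  \<^typ>\<open>real ^ ('n option)\<close>: the coordinate \<open>Some i\<close> is the old coordinate \<open>i\<close>, and
  \<open>None\<close> is the additional one.
\<close>

definition lifted_subspace :: "(real ^ 'n::finite) set \<Rightarrow> (real ^ ('n option)) set" where
  "lifted_subspace \<Gamma> = {\<xi>. (\<chi> i. \<xi> $ Some i) \<in> \<Gamma> \<and> (\<Sum>j\<in>UNIV. \<xi> $ j) = 0}"

text \<open>
  \<open>S\<close> is a graph over the variables indexed by \<open>I\<close>: every choice of values for these
  variables extends to exactly one point of \<open>S\<close>.
\<close>

definition graph_over :: "'k set \<Rightarrow> (real ^ 'k::finite) set \<Rightarrow> bool" where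
  "graph_over I S \<longleftrightarrow> (\<forall>c :: 'k \<Rightarrow> real. \<exists>!\<xi>. \<xi> \<in> S \<and> (\<forall>i\<in>I. \<xi> $ i = c i))"

definition nondegenerate_subspace :: "nat \<Rightarrow> (real ^ 'n::finite) set \<Rightarrow> bool" where
  "nondegenerate_subspace d \<Gamma> \<longleftrightarrow>
     subspace \<Gamma> \<and> dim \<Gamma> = d \<and>
     (\<forall>I :: 'n option set. card I = d \<longrightarrow> graph_over I (lifted_subspace \<Gamma>))"


section \<open>Mikhlin--Hoermander symbols adapted to a subspace\<close>

definition partial :: "'n \<Rightarrow> (real ^ 'n::finite \<Rightarrow> real) \<Rightarrow> real ^ 'n \<Rightarrow> real" where
  "partial i f \<xi> = deriv (\<lambda>t. f (\<xi> + t *\<^sub>R axis i 1)) 0"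

definition partials :: "'n list \<Rightarrow> (real ^ 'n::finite \<Rightarrow> real) \<Rightarrow> real ^ 'n \<Rightarrow> real" where
  "partials is f = foldr partial is f"

text \<open>
  The multi-index derivative applies \<open>\<gamma> i\<close> derivatives in direction \<open>i\<close>. The linear order on
  the indices only fixes the order of the derivatives, which is immaterial for smooth functions.
\<close>

definition multi_partial ::
  "('n \<Rightarrow> nat) \<Rightarrow> (real ^ 'n::{finite,linorder} \<Rightarrow> real) \<Rightarrow> real ^ 'n::{finite,linorder} \<Rightarrow> real" where
  "multi_partial \<gamma> f =
     partials (concat (map (\<lambda>i. replicate (\<gamma> i) i) (sorted_list_of_set UNIV))) f"

text \<open>Smoothness, for open \<open>U\<close>: all iterated partial derivatives are differentiable on \<open>U\<close>.\<close>

definition smooth_on :: "(real ^ 'n::finite) set \<Rightarrow> (real ^ 'n \<Rightarrow> real) \<Rightarrow> bool" where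
  "smooth_on U f \<longleftrightarrow> (\<forall>is. \<forall>\<xi>\<in>U. partials is f differentiable (at \<xi>))"

text \<open>
  Values of the symbol on \<open>\<Gamma>\<close> itself are unrestricted. The zero multi-index makes the symbol
  bounded off \<open>\<Gamma>\<close>.
\<close>

definition adapted_symbols :: "(real ^ 'n::{finite,linorder}) set \<Rightarrow> (real ^ 'n::{finite,linorder} \<Rightarrow> real) set" where
  "adapted_symbols \<Gamma> = {m. smooth_on (- \<Gamma>) m \<and>
     (\<forall>\<gamma>. \<exists>C::real. \<forall>\<xi>. \<xi> \<notin> \<Gamma> \<longrightarrow>
        \<bar>multi_partial \<gamma> m \<xi>\<bar> \<le> C * inverse (infdist \<xi> \<Gamma> ^ (\<Sum>i\<in>UNIV. \<gamma> i)))}"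


section \<open>Multilinear multipliers\<close>

definition nth_derivative :: "nat \<Rightarrow> (real \<Rightarrow> complex) \<Rightarrow> real \<Rightarrow> complex" where
  "nth_derivative k f = ((\<lambda>g x. vector_derivative g (at x)) ^^ k) f"

definition schwartz :: "(real \<Rightarrow> complex) set" where
  "schwartz = {f. (\<forall>k x. nth_derivative k f differentiable (at x)) \<and>
     (\<forall>k l. \<exists>C. \<forall>x. \<bar>x\<bar> ^ l * norm (nth_derivative k f x) \<le> C)}"

definition fourier :: "(real \<Rightarrow> complex) \<Rightarrow> real \<Rightarrow> complex" where
  "fourier f \<xi> = (LINT x|lebesgue. f x * cis (- 2 * pi * x * \<xi>))"

text \<open>
  The measure is \<^term>\<open>lebesgue\<close> and not \<^term>\<open>lborel\<close>: a symbol that is smooth off a proper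
  subspace \<open>\<Gamma>\<close> has arbitrary values on \<open>\<Gamma>\<close>, so it need not be Borel measurable.
\<close>

definition multiplier_op ::
  "(real ^ 'n::finite \<Rightarrow> real) \<Rightarrow> ('n \<Rightarrow> real \<Rightarrow> complex) \<Rightarrow> real \<Rightarrow> complex" where
  "multiplier_op m f x =
     (LINT \<xi>|lebesgue. of_real (m \<xi>) *
        (\<Prod>j\<in>UNIV. fourier (f j) (\<xi> $ j) * cis (2 * pi * x * \<xi> $ j)))"


section \<open>\<open>L\<^sup>p\<close> estimates\<close>

text \<open>The \<open>L\<^sup>p\<close> (quasi-)norm on the real line, for \<open>0 < p \<le> \<infinity>\<close>, as an extended real.\<close>

definition Lp_norm :: "ennreal \<Rightarrow> (real \<Rightarrow> complex) \<Rightarrow> ennreal" where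
  "Lp_norm p f =
     (if p = \<infinity> then esssup lebesgue (\<lambda>x. ennreal (norm (f x)))
      else let I = (\<integral>\<^sup>+x. ennreal (norm (f x) powr enn2real p) \<partial>lebesgue)
           in if I = \<infinity> then \<infinity> else ennreal (enn2real I powr (1 / enn2real p)))"

text \<open>
  In \<^typ>\<open>ennreal\<close> one has \<open>inverse \<infinity> = 0\<close> and \<open>inverse 0 = \<infinity>\<close>, so the target exponent is
  infinite exactly when all \<open>p j\<close> are.
\<close>

definition satisfies_Lp_estimate ::
  "(('n::finite \<Rightarrow> real \<Rightarrow> complex) \<Rightarrow> real \<Rightarrow> complex) \<Rightarrow> ('n \<Rightarrow> ennreal) \<Rightarrow> bool" where
  "satisfies_Lp_estimate T p \<longleftrightarrow>
     (\<exists>C::real. \<forall>f. (\<forall>j. f j \<in> schwartz) \<longrightarrow>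
        Lp_norm (inverse (\<Sum>j\<in>UNIV. inverse (p j))) (T f)
          \<le> ennreal C * (\<Prod>j\<in>UNIV. Lp_norm (p j) (f j)))"

definition satisfies_no_Lp_estimates ::
  "(('n::finite \<Rightarrow> real \<Rightarrow> complex) \<Rightarrow> real \<Rightarrow> complex) \<Rightarrow> bool" where
  "satisfies_no_Lp_estimates T \<longleftrightarrow>
     \<not> (\<exists>p :: 'n \<Rightarrow> ennreal. (\<forall>j. 1 \<le> p j) \<and> satisfies_Lp_estimate T p)"

end

theory Submission
  imports Defs "HOL-Computational_Algebra.Polynomial" "HOL-Probability.Characteristic_Functions"
begin

text \<open>
  The symbol lives within bounded distance of \<open>\<Gamma>\<close>, where the adaptedness condition only asks for
  bounded derivatives. It is a sum of unit bumps at those \<open>k \<in> \<int>\<^sup>n\<close> near \<open>\<Gamma>\<close> with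
  \<open>\<Sum>\<^sub>j k\<^sub>j = 0\<close>, with signs \<open>\<Prod>\<^sub>j r(\<bar>k\<^sub>j\<bar>)\<close> for the Rudin--Shapiro sequence \<open>r\<close>.
  All inputs are \<open>f(x) = \<Sum> r(\<bar>l\<bar>) e(l x)\<close>, summed over \<open>\<bar>l\<bar> < N\<close>, times a wide Gaussian; as the
  trigonometric sum is \<open>O(N\<^sup>1\<^sup>/\<^sup>2)\<close> uniformly, the product of the input norms is \<open>O(N\<^sup>n\<^sup>/\<^sup>2)\<close>
  up to the scaling factor of the Gaussian. When the Gaussian gets wider the multiplier only sees
  the values of the symbol at lattice points, where the signs cancel, so that the output
  approaches the number of these \<open>k\<close> in the box of size \<open>N\<close> times a Gaussian of the same width.
  That number is at least a constant times \<open>N\<^sup>d\<^sup>-\<^sup>1\<close>, and \<open>d - 1 > n / 2\<close>.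
  Every non-degenerate subspace is admissible; uncountably many are obtained from generalised
  Reed--Solomon codes.
\<close>

subsection \<open>A family of non-degenerate subspaces\<close>

text \<open>The zero sum is there for coherence: packets at frequencies \<open>k_j\<close> multiply
  to a wave of frequency \<open>k_1 + ... + k_n\<close>, and only frequency 0 lets all terms add up
  on a whole interval. This costs one dimension, hence \<open>d - 1\<close>; for integers,
  \<open>(n + 3) / 2 <= d\<close> says exactly that \<open>d - 1\<close> exceeds
  \<open>n / 2\<close>, so the estimate fails by a power of \<open>N\<close>. One symbol has to
  defeat the estimate for all \<open>N\<close> at once. The signs must therefore come from a single
  infinite sequence whose dyadic initial blocks all have trigonometric sums of square-root size,
  which rules out choosing new random signs for each \<open>N\<close>. The same inputs serve all
  exponents: each has absolute value at most \<open>O(sqrt N)\<close> times a Gaussian, and the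
  output is bounded below pointwise on an interval as long as the Gaussian is wide, which also
  covers target exponents below 1. The relation between the exponents cancels the width, so it may
  be chosen after \<open>N\<close>, as large as convergence at the finitely many lattice points of
  the box requires.\<close>

definition node_prod :: "('k \<Rightarrow> real) \<Rightarrow> 'k set \<Rightarrow> real poly" where
  "node_prod \<tau> B = (\<Prod>i\<in>B. [:- \<tau> i, 1:])"

definition lagrange_poly :: "('k \<Rightarrow> real) \<Rightarrow> 'k set \<Rightarrow> ('k \<Rightarrow> real) \<Rightarrow> real poly" where
  "lagrange_poly \<tau> A c =
     (\<Sum>j\<in>A. smult (c j / poly (node_prod \<tau> (A - {j})) (\<tau> j)) (node_prod \<tau> (A - {j})))"

lemma poly_node_prod: "poly (node_prod \<tau> B) x = (\<Prod>i\<in>B. x - \<tau> i)"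
  by (simp add: node_prod_def poly_prod)

lemma degree_node_prod: "degree (node_prod \<tau> B) = card B"
  unfolding node_prod_def by (subst degree_prod_eq_sum_degree) auto

lemma coeff_node_prod: "coeff (node_prod \<tau> B) (card B) = 1"
proof -
  have "lead_coeff (node_prod \<tau> B) = 1"
    unfolding node_prod_def lead_coeff_prod by simp
  then show ?thesis
    by (simp add: degree_node_prod)
qed

lemma poly_lagrange_poly:
  assumes "finite A" "inj_on \<tau> A" "k \<in> A"
  shows "poly (lagrange_poly \<tau> A c) (\<tau> k) = c k"
proof -
  have z: "poly (node_prod \<tau> (A - {j})) (\<tau> k) = 0" if "j \<noteq> k" for j
    using assms that unfolding poly_node_prod by (intro prod_zero) auto
  have nz: "poly (node_prod \<tau> (A - {k})) (\<tau> k) \<noteq> 0"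
    using assms unfolding poly_node_prod by (auto simp: prod_zero_iff inj_on_def)
  have "poly (lagrange_poly \<tau> A c) (\<tau> k) =
      (\<Sum>j\<in>A. if j = k then c k else 0)"
    unfolding lagrange_poly_def poly_sum by (rule sum.cong) (use z nz in auto)
  then show ?thesis
    using assms by simp
qed

lemma degree_lagrange_poly:
  assumes "finite A" "A \<noteq> {}"
  shows "degree (lagrange_poly \<tau> A c) < card A"
proof -
  have "degree (lagrange_poly \<tau> A c) \<le> card A - 1"
    unfolding lagrange_poly_def
    by (rule degree_sum_le) (use assms in \<open>auto intro: order_trans[OF degree_smult_le] simp: degree_node_prod\<close>)
  moreover have "0 < card A"
    using assms by (simp add: card_gt_0_iff)
  ultimately show ?thesis
    by linarith
qed

lemma poly_eqI_nodes:
  fixes p q :: "real poly"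
  assumes "inj_on \<tau> A" "degree p < card A" "degree q < card A"
    and "\<And>i. i \<in> A \<Longrightarrow> poly p (\<tau> i) = poly q (\<tau> i)"
  shows "p = q"
  by (rule poly_eqI_degree[of "\<tau> ` A"]) (use assms in \<open>auto simp: card_image\<close>)

text \<open>The sum is the coefficient of degree \<open>card A - 1\<close> in the Lagrange
  interpolant of \<open>p\<close> on \<open>A\<close>. Since \<open>p\<close> has smaller degree, it
  is its own interpolant and this coefficient vanishes.\<close>

lemma sum_divided_difference_eq_0:
  fixes p :: "real poly"
  assumes "finite A" "inj_on \<tau> A" "Suc (degree p) < card A"
  shows "(\<Sum>j\<in>A. poly p (\<tau> j) / poly (node_prod \<tau> (A - {j})) (\<tau> j)) = 0"
proof -
  have ne: "A \<noteq> {}"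
    using assms by auto
  have p: "lagrange_poly \<tau> A (\<lambda>j. poly p (\<tau> j)) = p"
    using assms poly_lagrange_poly[OF assms(1,2)]
    by (intro poly_eqI_nodes[OF assms(2)] degree_lagrange_poly[OF assms(1) ne]) auto
  have "0 = coeff p (card A - 1)"
    using assms by (intro coeff_eq_0[symmetric]) auto
  also have "\<dots> = (\<Sum>j\<in>A. poly p (\<tau> j) / poly (node_prod \<tau> (A - {j})) (\<tau> j)
      * coeff (node_prod \<tau> (A - {j})) (card A - 1))"
    by (subst p[symmetric]) (simp add: lagrange_poly_def coeff_sum)
  also have "\<dots> = (\<Sum>j\<in>A. poly p (\<tau> j) / poly (node_prod \<tau> (A - {j})) (\<tau> j))"
  proof (rule sum.cong)
    fix j assume "j \<in> A"
    then show "poly p (\<tau> j) / poly (node_prod \<tau> (A - {j})) (\<tau> j)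
      * coeff (node_prod \<tau> (A - {j})) (card A - 1) = poly p (\<tau> j) / poly (node_prod \<tau> (A - {j})) (\<tau> j)"
      using coeff_node_prod[of \<tau> "A - {j}"] assms(1) by simp
  qed simp
  finally show ?thesis
    by simp
qed

section \<open>Generalised Reed-Solomon codes and their non-degeneracy\<close>

definition node_weight :: "('k \<Rightarrow> real) \<Rightarrow> 'k::finite \<Rightarrow> real" where
  "node_weight \<tau> j = poly (node_prod \<tau> (UNIV - {j})) (\<tau> j)"

lemma node_weight_nonzero: "inj \<tau> \<Longrightarrow> node_weight \<tau> j \<noteq> 0"
  by (auto simp: node_weight_def poly_node_prod inj_def)

text \<open>
  A generalised Reed--Solomon code. With these weights the sum of the coordinates of a codeword is
  a divided difference of order \<open>CARD('k) - 1\<close> of a polynomial of smaller degree.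
\<close>

definition reed_solomon_code :: "nat \<Rightarrow> ('k \<Rightarrow> real) \<Rightarrow> (real ^ 'k::finite) set" where
  "reed_solomon_code d \<tau> = {\<xi>. \<exists>p. degree p < d \<and> (\<forall>j. \<xi> $ j = poly p (\<tau> j) / node_weight \<tau> j)}"

text \<open>This is the MDS property of the code: a polynomial of degree below \<open>d\<close> can
  be prescribed at any \<open>d\<close> distinct nodes and is fixed by its values there.\<close>

lemma graph_over_reed_solomon_code:
  assumes "inj \<tau>" "0 < d" "card I = d"
  shows "graph_over I (reed_solomon_code d \<tau>)"
  unfolding graph_over_def
proof (intro allI ex_ex1I)
  fix c :: "'a \<Rightarrow> real"
  have I: "finite I" "I \<noteq> {}" "inj_on \<tau> I"
    using assms by (auto simp: inj_on_def inj_def)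
  let ?p = "lagrange_poly \<tau> I (\<lambda>j. c j * node_weight \<tau> j)"
  have "(\<chi> j. poly ?p (\<tau> j) / node_weight \<tau> j) \<in> reed_solomon_code d \<tau>"
    unfolding reed_solomon_code_def using degree_lagrange_poly[OF I(1,2)] assms(3) by auto
  moreover have "\<forall>i\<in>I. (\<chi> j. poly ?p (\<tau> j) / node_weight \<tau> j) $ i = c i"
    using poly_lagrange_poly[OF I(1,3)] node_weight_nonzero[OF assms(1)] by auto
  ultimately show "\<exists>\<xi>. \<xi> \<in> reed_solomon_code d \<tau> \<and> (\<forall>i\<in>I. \<xi> $ i = c i)"
    by blast
  fix \<xi> \<eta>
  assume \<xi>: "\<xi> \<in> reed_solomon_code d \<tau> \<and> (\<forall>i\<in>I. \<xi> $ i = c i)" and \<eta>: "\<eta> \<in> reed_solomon_code d \<tau> \<and> (\<forall>i\<in>I. \<eta> $ i = c i)"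
  obtain p where p: "degree p < d" "\<And>j. \<xi> $ j = poly p (\<tau> j) / node_weight \<tau> j"
    using \<xi> by (auto simp: reed_solomon_code_def)
  obtain q where q: "degree q < d" "\<And>j. \<eta> $ j = poly q (\<tau> j) / node_weight \<tau> j"
    using \<eta> by (auto simp: reed_solomon_code_def)
  have "poly p (\<tau> i) = poly q (\<tau> i)" if "i \<in> I" for i
    using that \<xi> \<eta> p(2)[of i] q(2)[of i] node_weight_nonzero[OF assms(1), of i] by simp
  then have "p = q"
    using p(1) q(1) assms(3) by (intro poly_eqI_nodes[OF I(3)]) auto
  then show "\<xi> = \<eta>"
    using p(2) q(2) by (simp add: vec_eq_iff)
qed

lemma sum_reed_solomon_code_eq_0:
  fixes \<tau> :: "'k::finite \<Rightarrow> real"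
  assumes "inj \<tau>" "d < CARD('k)" "\<xi> \<in> reed_solomon_code d \<tau>"
  shows "(\<Sum>j\<in>UNIV. \<xi> $ j) = 0"
proof -
  obtain p where p: "degree p < d" "\<And>j. \<xi> $ j = poly p (\<tau> j) / node_weight \<tau> j"
    using assms(3) by (auto simp: reed_solomon_code_def)
  show ?thesis
    unfolding p(2) node_weight_def
    using assms p(1) by (intro sum_divided_difference_eq_0) auto
qed

definition reed_solomon_subspace :: "nat \<Rightarrow> ('n option \<Rightarrow> real) \<Rightarrow> (real ^ 'n::finite) set" where
  "reed_solomon_subspace d \<tau> = (\<lambda>\<xi>. \<chi> i. \<xi> $ Some i) ` reed_solomon_code d \<tau>"

text \<open>Codewords have sum zero, so the dropped coordinate \<open>None\<close> can be recovered
  from the others. The lift is thus the code itself, and the MDS property becomes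
  non-degeneracy.\<close>

lemma lifted_reed_solomon_subspace:
  fixes \<tau> :: "'n::finite option \<Rightarrow> real"
  assumes "inj \<tau>" "d < CARD('n option)"
  shows "lifted_subspace (reed_solomon_subspace d \<tau>) = reed_solomon_code d \<tau>"
proof (intro equalityI subsetI)
  fix \<xi> :: "real ^ 'n option"
  assume "\<xi> \<in> lifted_subspace (reed_solomon_subspace d \<tau>)"
  then obtain \<eta> where \<eta>: "\<eta> \<in> reed_solomon_code d \<tau>" "\<And>i. \<xi> $ Some i = \<eta> $ Some i" "(\<Sum>j\<in>UNIV. \<xi> $ j) = 0"
    by (auto simp: lifted_subspace_def reed_solomon_subspace_def vec_eq_iff)
  have "(\<Sum>j\<in>UNIV. \<eta> $ j) = 0"
    by (rule sum_reed_solomon_code_eq_0[OF assms \<eta>(1)])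
  then have "\<xi> $ None = \<eta> $ None"
    using \<eta>(2,3) by (simp add: UNIV_option_conv sum.reindex)
  then have "\<xi> = \<eta>"
    using \<eta>(2) by (simp add: vec_eq_iff split_option_all)
  then show "\<xi> \<in> reed_solomon_code d \<tau>"
    using \<eta>(1) by simp
next
  fix \<xi> :: "real ^ 'n option"
  assume "\<xi> \<in> reed_solomon_code d \<tau>"
  then show "\<xi> \<in> lifted_subspace (reed_solomon_subspace d \<tau>)"
    using sum_reed_solomon_code_eq_0[OF assms] by (auto simp: lifted_subspace_def reed_solomon_subspace_def)
qed

lemma subspace_reed_solomon_code:
  assumes "0 < d"
  shows "subspace (reed_solomon_code d \<tau>)"
proof (rule subspaceI)
  show "0 \<in> reed_solomon_code d \<tau>"
    using assms by (auto simp: reed_solomon_code_def intro!: exI[of _ 0])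
  fix x y assume "x \<in> reed_solomon_code d \<tau>" "y \<in> reed_solomon_code d \<tau>"
  then obtain p q where "degree p < d" "\<And>j. x $ j = poly p (\<tau> j) / node_weight \<tau> j"
    "degree q < d" "\<And>j. y $ j = poly q (\<tau> j) / node_weight \<tau> j"
    by (auto simp: reed_solomon_code_def)
  then show "x + y \<in> reed_solomon_code d \<tau>"
    by (auto simp: reed_solomon_code_def add_divide_distrib intro!: exI[of _ "p + q"] degree_add_less)
next
  fix c :: real and x assume "x \<in> reed_solomon_code d \<tau>"
  then obtain p where "degree p < d" "\<And>j. x $ j = poly p (\<tau> j) / node_weight \<tau> j"
    by (auto simp: reed_solomon_code_def)
  then show "c *\<^sub>R x \<in> reed_solomon_code d \<tau>"
    by (auto simp: reed_solomon_code_def intro!: exI[of _ "smult c p"] order.strict_trans1[OF degree_smult_le])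
qed

lemma dim_coordinate_subspace: "dim {x :: real ^ 'n::finite. \<forall>i. i \<notin> J \<longrightarrow> x $ i = 0} = card J"
proof -
  have "dim {x :: real ^ 'n. \<forall>b\<in>Basis. b \<notin> (\<lambda>i. axis i 1) ` J \<longrightarrow> x \<bullet> b = 0} = card ((\<lambda>i. axis i (1::real)) ` J)"
    by (rule dim_substandard) (auto simp: axis_in_Basis_iff)
  also have "card ((\<lambda>i. axis i (1::real)) ` J) = card J"
    by (rule card_image) (auto simp: inj_on_def axis_eq_axis)
  also have "{x :: real ^ 'n. \<forall>b\<in>Basis. b \<notin> (\<lambda>i. axis i 1) ` J \<longrightarrow> x \<bullet> b = 0} =
      {x. \<forall>i. i \<notin> J \<longrightarrow> x $ i = 0}"
    by (auto simp: Basis_vec_def inner_axis image_iff axis_eq_axis)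
  finally show ?thesis .
qed

lemma nondegenerate_reed_solomon_subspace:
  fixes \<tau> :: "'n::finite option \<Rightarrow> real"
  assumes "inj \<tau>" "0 < d" "d < CARD('n)"
  shows "nondegenerate_subspace d (reed_solomon_subspace d \<tau>)"
proof -
  have d: "d < CARD('n option)"
    using assms(3) by simp
  let ?r = "\<lambda>\<xi> :: real ^ 'n option. (\<chi> i. \<xi> $ Some i) :: real ^ 'n"
  have r: "linear ?r"
    by (auto simp: linear_iff vec_eq_iff)
  have sub: "subspace (reed_solomon_subspace d \<tau>)"
    unfolding reed_solomon_subspace_def by (intro linear_subspace_image r subspace_reed_solomon_code assms)
  obtain J :: "'n set" where J: "card J = d"
    using obtain_subset_with_card_n[of d "UNIV :: 'n set"] assms(3) by auto
  have g: "graph_over (Some ` J) (reed_solomon_code d \<tau>)"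
    by (rule graph_over_reed_solomon_code[OF assms(1,2)]) (simp add: card_image J)
  \<comment> \<open>Keeping only the coordinates in \<open>J\<close> maps the subspace bijectively
    onto a coordinate subspace of dimension \<open>d\<close>; injectivity and surjectivity are the
    two halves of the graph property over \<open>J\<close>.\<close>
  let ?\<pi> = "\<lambda>\<xi> :: real ^ 'n. (\<chi> i. if i \<in> J then \<xi> $ i else 0) :: real ^ 'n"
  have lin: "linear ?\<pi>"
    by (auto simp: linear_iff vec_eq_iff)
  have "inj_on ?\<pi> (reed_solomon_subspace d \<tau>)"
  proof (rule inj_onI)
    fix x y assume x: "x \<in> reed_solomon_subspace d \<tau>" and y: "y \<in> reed_solomon_subspace d \<tau>" and eq: "?\<pi> x = ?\<pi> y"
    obtain \<xi> where \<xi>: "\<xi> \<in> reed_solomon_code d \<tau>" "x = ?r \<xi>"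
      using x by (auto simp: reed_solomon_subspace_def)
    obtain \<eta> where \<eta>: "\<eta> \<in> reed_solomon_code d \<tau>" "y = ?r \<eta>"
      using y by (auto simp: reed_solomon_subspace_def)
    have "\<forall>i\<in>Some ` J. \<xi> $ i = \<eta> $ i"
      using eq by (auto simp: vec_eq_iff \<xi> \<eta> split: if_splits)
    moreover have "\<exists>!z. z \<in> reed_solomon_code d \<tau> \<and> (\<forall>i\<in>Some ` J. z $ i = \<eta> $ i)"
      using g[unfolded graph_over_def, rule_format, of "\<lambda>i. \<eta> $ i"] .
    ultimately have "\<xi> = \<eta>"
      using \<xi>(1) \<eta>(1) by auto
    then show "x = y"
      by (simp add: \<xi> \<eta>)
  qed
  moreover have "?\<pi> ` reed_solomon_subspace d \<tau> = {x. \<forall>i. i \<notin> J \<longrightarrow> x $ i = 0}"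
  proof (intro equalityI subsetI)
    fix x :: "real ^ 'n" assume x: "x \<in> {x. \<forall>i. i \<notin> J \<longrightarrow> x $ i = 0}"
    obtain \<xi> where \<xi>: "\<xi> \<in> reed_solomon_code d \<tau>" "\<forall>i\<in>Some ` J. \<xi> $ i = (case i of None \<Rightarrow> 0 | Some i \<Rightarrow> x $ i)"
      using g[unfolded graph_over_def, rule_format, of "\<lambda>i. case i of None \<Rightarrow> 0 | Some i \<Rightarrow> x $ i"] by blast
    have "x = ?\<pi> (?r \<xi>)"
      using \<xi>(2) x by (auto simp: vec_eq_iff)
    then show "x \<in> ?\<pi> ` reed_solomon_subspace d \<tau>"
      unfolding reed_solomon_subspace_def using \<xi>(1) by blast
  qed auto
  ultimately have "dim (reed_solomon_subspace d \<tau>) = d"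
    using dim_image_eq[OF lin, of "reed_solomon_subspace d \<tau>"] dim_coordinate_subspace[of J] J
    by (simp add: span_eq_iff[THEN iffD2, OF sub])
  then show ?thesis
    unfolding nondegenerate_subspace_def lifted_reed_solomon_subspace[OF assms(1) d]
    using sub graph_over_reed_solomon_code[OF assms(1,2)] by blast
qed

section \<open>A one-parameter family: all nodes fixed except the one at \<open>None\<close>\<close>

definition extend_nodes :: "('n \<Rightarrow> real) \<Rightarrow> real \<Rightarrow> 'n option \<Rightarrow> real" where
  "extend_nodes t s = case_option s t"

lemma inj_extend_nodes:
  assumes "inj t" "s \<notin> range t"
  shows "inj (extend_nodes t s)"
  using assms by (auto simp: inj_def extend_nodes_def split: option.splits)

lemma node_weight_extend_nodes:
  "node_weight (extend_nodes t s) (Some i) = (t i - s) * node_weight t i"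
proof -
  have "UNIV - {Some i} = insert None (Some ` (UNIV - {i}))"
    by (auto simp: UNIV_option_conv)
  then show ?thesis
    by (simp add: node_weight_def poly_node_prod extend_nodes_def prod.reindex)
qed

text \<open>The codeword of the constant polynomial 1 for the node \<open>s\<close> must come from
  some \<open>q\<close> for the node \<open>s'\<close>. Comparing weights gives
  \<open>t i - s' = q(t i) (t i - s)\<close> at all \<open>n\<close> nodes. Both sides have degree
  at most \<open>d < n\<close>, so this is an identity of polynomials, and evaluating it at
  \<open>s\<close> yields \<open>s = s'\<close>.\<close>

lemma reed_solomon_subspace_inject:
  fixes t :: "'n::finite \<Rightarrow> real"
  assumes t: "inj t" and s: "s \<notin> range t" "s' \<notin> range t" and d: "0 < d" "d < CARD('n)"
    and eq: "reed_solomon_subspace d (extend_nodes t s) = reed_solomon_subspace d (extend_nodes t s')"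
  shows "s = s'"
proof -
  have "(\<chi> j. 1 / node_weight (extend_nodes t s) j) \<in> reed_solomon_code d (extend_nodes t s)"
    using d by (auto simp: reed_solomon_code_def intro!: exI[of _ 1])
  then have "(\<chi> i. 1 / node_weight (extend_nodes t s) (Some i)) \<in> reed_solomon_subspace d (extend_nodes t s)"
    unfolding reed_solomon_subspace_def by (rule image_eqI[rotated]) (simp add: vec_eq_iff)
  then have "(\<chi> i. 1 / node_weight (extend_nodes t s) (Some i)) \<in> reed_solomon_subspace d (extend_nodes t s')"
    by (simp only: eq)
  then obtain q where q: "degree q < d"
    "\<And>i. 1 / node_weight (extend_nodes t s) (Some i) = poly q (t i) / node_weight (extend_nodes t s') (Some i)"
    by (auto simp: reed_solomon_subspace_def reed_solomon_code_def vec_eq_iff extend_nodes_def)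
  have "[:- s', 1:] = q * [:- s, 1:]"
  proof (rule poly_eqI_nodes[of t UNIV])
    show "degree [:- s', 1:] < card (UNIV :: 'n set)"
      using d by simp
    have "degree (q * [:- s, 1:]) \<le> degree q + 1"
      by (rule order_trans[OF degree_mult_le]) simp
    then show "degree (q * [:- s, 1:]) < card (UNIV :: 'n set)"
      using q(1) d by linarith
    fix i
    have "t i \<noteq> s" "t i \<noteq> s'"
      using s by auto
    then have "(t i - s') * node_weight t i = (poly q (t i) * (t i - s)) * node_weight t i"
      using q(2)[of i] node_weight_nonzero[OF t, of i]
      by (simp add: node_weight_extend_nodes divide_simps mult_ac split: if_splits)
    then have "t i - s' = poly q (t i) * (t i - s)"
      using node_weight_nonzero[OF t, of i] by simp
    then show "poly [:- s', 1:] (t i) = poly (q * [:- s, 1:]) (t i)"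
      by (simp add: algebra_simps)
  qed (fact t)
  then have "poly [:- s', 1:] s = poly (q * [:- s, 1:]) s"
    by simp
  then show ?thesis
    by simp
qed

lemma uncountable_nondegenerate_subspaces:
  assumes "0 < d" "d < CARD('n::finite)"
  shows "uncountable {\<Gamma> :: (real ^ 'n) set. nondegenerate_subspace d \<Gamma>}"
proof
  assume countable: "countable {\<Gamma> :: (real ^ 'n) set. nondegenerate_subspace d \<Gamma>}"
  obtain h :: "'n \<Rightarrow> nat" where h: "inj h"
    using finite_imp_inj_to_nat_seg[of "UNIV :: 'n set"] by auto
  define t where "t i = real (h i)" for i
  have t: "inj t"
    using h by (auto simp: t_def inj_def)
  let ?S = "- range t"
  let ?\<Gamma> = "\<lambda>s. reed_solomon_subspace d (extend_nodes t s)"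
  have "?\<Gamma> ` ?S \<subseteq> {\<Gamma>. nondegenerate_subspace d \<Gamma>}"
    using nondegenerate_reed_solomon_subspace[OF inj_extend_nodes[OF t] assms] by auto
  then have "countable (?\<Gamma> ` ?S)"
    using countable countable_subset by blast
  moreover have "inj_on ?\<Gamma> ?S"
    using reed_solomon_subspace_inject[OF t _ _ assms] by (auto simp: inj_on_def)
  ultimately have "countable ?S"
    using countable_image_inj_on by blast
  then have "countable (?S \<union> range t)"
    by (intro countable_Un) auto
  then show False
    using uncountable_UNIV_real by simp
qed


subsection \<open>Smooth bump functions\<close>

text \<open>The derivatives of \<open>exp (-1 / (1 - x^2))\<close> on the unit interval all have
  this shape. With \<open>P\<close> and \<open>k\<close> as parameters the family is closed under
  differentiation, so one derivative formula yields smoothness.\<close>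

definition bump_term :: "real poly \<Rightarrow> nat \<Rightarrow> real \<Rightarrow> real" where
  "bump_term P k x =
     (if \<bar>x\<bar> < 1 then poly P x * inverse (1 - x\<^sup>2) ^ k * exp (- inverse (1 - x\<^sup>2)) else 0)"

text \<open>\<open>[:1, 0, -1:]\<close> is \<open>1 - x^2\<close>. The three summands come from
  differentiating the polynomial, the power and the exponential, brought to the common denominator
  \<open>(1 - x^2)^(k + 2)\<close>.\<close>

definition bump_step :: "real poly \<Rightarrow> nat \<Rightarrow> real poly" where
  "bump_step P k = pderiv P * [:1, 0, -1:]\<^sup>2 + smult (2 * real k) ([:0, 1:] * P * [:1, 0, -1:])
     - smult 2 ([:0, 1:] * P)"

lemma power_le_fact_exp:
  fixes y :: real
  assumes "0 \<le> y"
  shows "y ^ k \<le> fact k * exp y"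
proof -
  have "y ^ k / fact k \<le> (\<Sum>n. y ^ n / fact n)"
    using sum_le_suminf[of "\<lambda>n. y ^ n / fact n" "{k}"] assms summable_exp[of y]
    by (auto simp: divide_inverse mult.commute)
  also have "\<dots> = exp y"
    by (simp add: exp_def divide_inverse mult.commute)
  finally show ?thesis
    by (simp add: field_simps)
qed

lemma has_real_derivative_quadratic_bound:
  fixes f :: "real \<Rightarrow> real"
  assumes "\<And>z. \<bar>f z\<bar> \<le> K * (z - x)\<^sup>2"
  shows "(f has_real_derivative 0) (at x)"
proof -
  have f0: "f x = 0"
    using assms[of x] by simp
  have "((\<lambda>h. f (x + h) / h) \<longlongrightarrow> 0) (at 0)"
  proof (rule Lim_null_comparison)
    have "norm (f (x + h) / h) \<le> K * \<bar>h\<bar>" for h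
    proof (cases "h = 0")
      case False
      have "\<bar>f (x + h)\<bar> \<le> K * \<bar>h\<bar> * \<bar>h\<bar>"
        using assms[of "x + h"] by (simp add: power2_eq_square mult.assoc)
      then show ?thesis
        using False by (simp add: pos_divide_le_eq)
    qed auto
    then show "\<forall>\<^sub>F h in at 0. norm (f (x + h) / h) \<le> K * \<bar>h\<bar>"
      by simp
    show "((\<lambda>h. K * \<bar>h\<bar>) \<longlongrightarrow> 0) (at 0)"
      by (auto intro!: tendsto_eq_intros)
  qed
  then show ?thesis
    by (simp add: DERIV_def f0)
qed

text \<open>With \<open>y = 1 / (1 - z^2)\<close> the exponential \<open>exp (-y)\<close> absorbs
  \<open>k + 2\<close> powers of \<open>y\<close>. The two powers to spare give a zero of second
  order at the endpoints, which is what differentiability there takes.\<close>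

lemma bump_term_bound:
  obtains K where "\<And>z. \<bar>bump_term P k z\<bar> \<le> K * (1 - z\<^sup>2)\<^sup>2" "0 \<le> K"
proof -
  have "compact (poly P ` {-1..1})"
    by (intro compact_continuous_image continuous_intros) auto
  then obtain M where M: "\<And>x. x \<in> {-1..1} \<Longrightarrow> \<bar>poly P x\<bar> \<le> M"
    using compact_imp_bounded[of "poly P ` {-1..1}"] unfolding bounded_iff by fastforce
  have M0: "0 \<le> M"
    using M[of 0] by auto
  have "\<bar>bump_term P k z\<bar> \<le> (M * fact (k + 2)) * (1 - z\<^sup>2)\<^sup>2" for z
  proof (cases "\<bar>z\<bar> < 1")
    case True
    define y where "y = inverse (1 - z\<^sup>2)"
    have z: "0 < 1 - z\<^sup>2"
      using True abs_square_less_1[of z] by simp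
    then have y: "0 < y"
      by (simp add: y_def)
    have "y ^ k * exp (-y) = (y ^ (k + 2) * exp (-y)) * (1 - z\<^sup>2)\<^sup>2"
    proof -
      have "y ^ k = y ^ k * (y * (1 - z\<^sup>2))\<^sup>2"
        using z by (simp add: y_def)
      then show ?thesis
        unfolding power_add power_mult_distrib by simp
    qed
    also have "\<dots> \<le> fact (k + 2) * (1 - z\<^sup>2)\<^sup>2"
      using power_le_fact_exp[of y "k + 2"] y
      by (intro mult_right_mono) (auto simp: exp_minus field_simps)
    finally have le: "y ^ k * exp (-y) \<le> fact (k + 2) * (1 - z\<^sup>2)\<^sup>2" .
    have "\<bar>poly P z\<bar> * (y ^ k * exp (-y)) \<le> M * (fact (k + 2) * (1 - z\<^sup>2)\<^sup>2)"
      by (rule mult_mono[OF M le M0]) (use True y in auto)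
    then show ?thesis
      using True y unfolding bump_term_def y_def[symmetric] by (simp add: abs_mult mult_ac)
  qed (use M0 in \<open>auto simp: bump_term_def\<close>)
  with that M0 show ?thesis
    by (meson fact_ge_zero mult_nonneg_nonneg)
qed

text \<open>Only the endpoints need care: there the bound by \<open>(1 - z^2)^2\<close> forces the
  derivative 0, which agrees with the default value of the next \<open>bump_term\<close>.\<close>

lemma bump_term_has_derivative:
  "(bump_term P k has_real_derivative bump_term (bump_step P k) (k + 2) x) (at x)"
proof -
  consider "\<bar>x\<bar> < 1" | "\<bar>x\<bar> > 1" | "\<bar>x\<bar> = 1"
    by linarith
  then show ?thesis
  proof cases
    case 1
    have x: "0 < 1 - x\<^sup>2"
      using 1 abs_square_less_1[of x] by simp
    define y where "y = inverse (1 - x\<^sup>2)"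
    have y0: "y > 0" and xy: "(1 - x\<^sup>2) * y = 1"
      using x by (auto simp: y_def)
    have dy: "((\<lambda>x. inverse (1 - x\<^sup>2)) has_real_derivative 2 * x * y\<^sup>2) (at x)"
      using x by (auto intro!: derivative_eq_intros simp: y_def power2_eq_square)
    have yk: "real k * y ^ (k - Suc 0) * y\<^sup>2 = real k * y ^ (k + 1)"
      by (cases k) (auto simp: power2_eq_square)
    have chain: "((\<lambda>x. poly P x * Y x ^ k * exp (- Y x)) has_real_derivative
       (poly (pderiv P) x * Y x ^ k + poly P x * (real k * Y x ^ (k - Suc 0) * d)) * exp (- Y x)
         - poly P x * Y x ^ k * exp (- Y x) * d) (at x)"
      if "(Y has_real_derivative d) (at x)" for Y d
      by (rule derivative_eq_intros that refl poly_DERIV)+ (simp add: algebra_simps)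
    have "((\<lambda>x. poly P x * inverse (1 - x\<^sup>2) ^ k * exp (- inverse (1 - x\<^sup>2))) has_real_derivative
       (poly (pderiv P) x * y ^ k + poly P x * (real k * y ^ (k - Suc 0) * y\<^sup>2) * (2 * x)) * exp (-y)
         - poly P x * y ^ k * exp (-y) * (2 * x * y\<^sup>2)) (at x)"
      using chain[OF dy] by (simp add: y_def[symmetric] mult_ac)
    moreover have "(poly (pderiv P) x * y ^ k + poly P x * (real k * y ^ (k - Suc 0) * y\<^sup>2) * (2 * x)) * exp (-y)
         - poly P x * y ^ k * exp (-y) * (2 * x * y\<^sup>2) = bump_term (bump_step P k) (k + 2) x"
    proof -
      have "poly (bump_step P k) x * y ^ (k + 2) =
        poly (pderiv P) x * y ^ k * ((1 - x\<^sup>2) * y)\<^sup>2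
        + 2 * real k * x * poly P x * y ^ (k + 1) * ((1 - x\<^sup>2) * y) - 2 * x * poly P x * y ^ (k + 2)"
        by (simp add: bump_step_def algebra_simps power2_eq_square power_add)
      then have A: "poly (bump_step P k) x * y ^ (k + 2) =
        poly (pderiv P) x * y ^ k + 2 * real k * x * poly P x * y ^ (k + 1) - 2 * x * poly P x * y ^ (k + 2)"
        unfolding xy by simp
      have "bump_term (bump_step P k) (k + 2) x = poly (bump_step P k) x * y ^ (k + 2) * exp (-y)"
        unfolding bump_term_def y_def using 1 by simp
      then show ?thesis
        unfolding yk A by (simp add: algebra_simps power2_eq_square)
    qed
    ultimately have *: "((\<lambda>x. poly P x * inverse (1 - x\<^sup>2) ^ k * exp (- inverse (1 - x\<^sup>2))) has_real_derivative
        bump_term (bump_step P k) (k + 2) x) (at x)"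
      by simp
    show ?thesis
      by (rule has_field_derivative_transform_within_open[OF *, of "{-1<..<1}"])
        (use 1 in \<open>auto simp: bump_term_def\<close>)
  next
    case 2
    have *: "((\<lambda>x. 0) has_real_derivative 0) (at x)"
      by simp
    have "(bump_term P k has_real_derivative 0) (at x)"
      by (rule has_field_derivative_transform_within_open[OF *, of "- {-1..1}"])
        (use 2 in \<open>auto simp: bump_term_def\<close>)
    then show ?thesis
      using 2 by (simp add: bump_term_def)
  next
    case 3
    obtain K where K: "\<And>z. \<bar>bump_term P k z\<bar> \<le> K * (1 - z\<^sup>2)\<^sup>2" "0 \<le> K"
      by (rule bump_term_bound[of P k]) blast
    have "(bump_term P k has_real_derivative 0) (at x)"
    proof (rule has_real_derivative_quadratic_bound)
      fix z
      show "\<bar>bump_term P k z\<bar> \<le> (K * 4) * (z - x)\<^sup>2"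
      proof (cases "\<bar>z\<bar> < 1")
        case True
        have "x = 1 \<or> x = -1"
          using 3 by linarith
        then have "(1 - z\<^sup>2)\<^sup>2 = (z + x)\<^sup>2 * (z - x)\<^sup>2"
          by (auto simp: power2_eq_square algebra_simps)
        also have "(z + x)\<^sup>2 \<le> 2\<^sup>2"
          using True 3 by (intro abs_le_square_iff[THEN iffD1]) auto
        then have "(z + x)\<^sup>2 * (z - x)\<^sup>2 \<le> 4 * (z - x)\<^sup>2"
          by (intro mult_right_mono) auto
        finally show ?thesis
          using K(1)[of z] mult_left_mono[OF _ K(2), of "(1 - z\<^sup>2)\<^sup>2" "4 * (z - x)\<^sup>2"] by simp
      qed (use K in \<open>auto simp: bump_term_def\<close>)
    qed
    then show ?thesis
      using 3 by (simp add: bump_term_def)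
  qed
qed

fun bump_poly :: "nat \<Rightarrow> real poly" where
  "bump_poly 0 = 1"
| "bump_poly (Suc k) = bump_step (bump_poly k) (2 * k)"

text \<open>\<open>exp 1\<close> normalises the value at 0 to 1, the argument \<open>4 * x\<close>
  shrinks the support to radius 1/4, and \<open>4 ^ k\<close> is the resulting chain rule factor, so
  that \<open>bump k\<close> is the \<open>k\<close>-th derivative of \<open>bump 0\<close>.\<close>

definition bump :: "nat \<Rightarrow> real \<Rightarrow> real" where
  "bump k x = exp 1 * 4 ^ k * bump_term (bump_poly k) (2 * k) (4 * x)"

lemma bump_0_0: "bump 0 0 = 1"
  by (simp add: bump_def bump_term_def exp_minus)

lemma bump_eq_0: "1 / 4 \<le> \<bar>x\<bar> \<Longrightarrow> bump k x = 0"
  by (simp add: bump_def bump_term_def abs_mult)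

lemma bump_has_derivative: "(bump k has_real_derivative bump (Suc k) x) (at x)"
proof -
  have *: "((\<lambda>x::real. 4 * x) has_real_derivative 4) (at x)"
    by (auto intro!: derivative_eq_intros)
  have "((\<lambda>x. bump_term (bump_poly k) (2 * k) (4 * x)) has_real_derivative
      bump_term (bump_poly (Suc k)) (2 * Suc k) (4 * x) * 4) (at x)"
    using DERIV_chain2[OF bump_term_has_derivative *, of "bump_poly k" "2 * k"] by simp
  then show ?thesis
    unfolding bump_def by (auto intro!: derivative_eq_intros)
qed

lemma bump_bounded: "\<exists>B. \<forall>x. \<bar>bump k x\<bar> \<le> B"
proof -
  have "continuous_on {-1..1} (bump k)"
    using bump_has_derivative DERIV_isCont continuous_at_imp_continuous_on by blast
  then have "bounded (bump k ` {-1..1})"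
    by (intro compact_imp_bounded compact_continuous_image) auto
  then obtain B where B: "\<And>x. x \<in> {-1..1} \<Longrightarrow> \<bar>bump k x\<bar> \<le> B"
    unfolding bounded_iff by fastforce
  have "\<bar>bump k x\<bar> \<le> B" for x
    using B[of x] B[of 0] by (cases "\<bar>x\<bar> \<le> 1") (auto simp: abs_le_iff bump_eq_0)
  then show ?thesis
    by blast
qed


subsection \<open>Symbols interpolating a function on the integer lattice\<close>

text \<open>A sum of bumps over the lattice, written as a single product: the supports around
  different lattice points are disjoint, so only the nearest one can contribute. The orders
  \<open>c j\<close> of differentiation are parameters in order that partial derivatives stay in the
  family.\<close>

definition lattice_symbol :: "('n \<Rightarrow> nat) \<Rightarrow> (('n \<Rightarrow> int) \<Rightarrow> real) \<Rightarrow> real ^ 'n::finite \<Rightarrow> real" where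
  "lattice_symbol c e \<xi> =
     e (\<lambda>j. round (\<xi> $ j)) * (\<Prod>j\<in>UNIV. bump (c j) (\<xi> $ j - of_int (round (\<xi> $ j))))"

text \<open>Rounding may be frozen near a point, which removes the discontinuity of
  \<open>round\<close>. If some coordinate of \<eta> rounds differently from that of \<xi>, it is at
  distance at least 1/4 from both integers, because \<xi> and \<eta> differ by less than 1/4 there;
  then both sides are 0. This gap is the reason for supports of radius 1/4 instead of 1/2.\<close>

lemma lattice_symbol_local:
  assumes "dist \<xi> \<eta> < 1 / 4"
  shows "lattice_symbol c e \<eta> =
    e (\<lambda>j. round (\<xi> $ j)) * (\<Prod>j\<in>UNIV. bump (c j) (\<eta> $ j - of_int (round (\<xi> $ j))))"
proof (cases "\<forall>j. round (\<eta> $ j) = round (\<xi> $ j)")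
  case False
  then obtain j where j: "round (\<eta> $ j) \<noteq> round (\<xi> $ j)"
    by blast
  have d: "\<bar>\<xi> $ j - \<eta> $ j\<bar> < 1 / 4"
    using dist_vec_nth_le[of \<xi> j \<eta>] assms by (simp add: dist_real_def)
  have "1 / 4 \<le> \<bar>\<eta> $ j - of_int (round (\<xi> $ j))\<bar>"
    using j round_unique'[of "\<eta> $ j" "round (\<xi> $ j)"] by linarith
  moreover have "1 / 4 \<le> \<bar>\<eta> $ j - of_int (round (\<eta> $ j))\<bar>"
    using j d round_unique'[of "\<xi> $ j" "round (\<eta> $ j)"] by linarith
  ultimately have "(\<Prod>j\<in>UNIV. bump (c j) (\<eta> $ j - of_int (round (\<xi> $ j)))) = 0"
    "(\<Prod>j\<in>UNIV. bump (c j) (\<eta> $ j - of_int (round (\<eta> $ j)))) = 0"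
    using bump_eq_0 by (meson UNIV_I finite prod_zero_iff)+
  then show ?thesis
    unfolding lattice_symbol_def by (simp only: mult_zero_right)
qed (simp add: lattice_symbol_def)

lemma lattice_symbol_differentiable:
  fixes c :: "'n::finite \<Rightarrow> nat"
  shows "lattice_symbol c e differentiable (at \<xi>)"
proof -
  let ?L = "\<lambda>\<eta>::real^'n. e (\<lambda>j. round (\<xi> $ j)) * (\<Prod>j\<in>UNIV. bump (c j) (\<eta> $ j - of_int (round (\<xi> $ j))))"
  have d: "(\<lambda>\<eta>::real^'n. bump (c j) (\<eta> $ j - of_int (round (\<xi> $ j)))) differentiable (at \<xi>)" for j
  proof -
    have "(\<lambda>\<eta>::real^'n. \<eta> $ j - of_int (round (\<xi> $ j))) differentiable (at \<xi>)"
      by (intro differentiable_diff differentiable_const bounded_linear_imp_differentiable bounded_linear_vec_nth)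
    moreover have "bump (c j) differentiable (at (\<xi> $ j - of_int (round (\<xi> $ j))))"
      using bump_has_derivative real_differentiable_def by blast
    ultimately show ?thesis
      using differentiable_chain_at[of "\<lambda>\<eta>::real^'n. \<eta> $ j - of_int (round (\<xi> $ j))" \<xi> "bump (c j)"]
      by (simp add: o_def)
  qed
  obtain D where D: "\<And>j. ((\<lambda>\<eta>::real^'n. bump (c j) (\<eta> $ j - of_int (round (\<xi> $ j)))) has_derivative D j) (at \<xi>)"
    using d unfolding differentiable_def by metis
  have "(\<lambda>\<eta>::real^'n. \<Prod>j\<in>UNIV. bump (c j) (\<eta> $ j - of_int (round (\<xi> $ j)))) differentiable (at \<xi>)"
    unfolding differentiable_def by (rule exI, rule has_derivative_prod, rule D)
  then have "?L differentiable (at \<xi>)"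
    by (intro differentiable_mult differentiable_const)
  then obtain D where "(?L has_derivative D) (at \<xi>)"
    by (auto simp: differentiable_def)
  then have "(lattice_symbol c e has_derivative D) (at \<xi>)"
    by (rule has_derivative_transform_within_open[of _ _ _ _ "ball \<xi> (1/4)"])
      (auto simp: lattice_symbol_local)
  then show ?thesis
    by (auto simp: differentiable_def)
qed

lemma partial_lattice_symbol:
  fixes c :: "'n::finite \<Rightarrow> nat"
  shows "partial i (lattice_symbol c e) = lattice_symbol (c(i := Suc (c i))) e"
proof
  fix \<xi> :: "real ^ 'n"
  let ?k = "\<lambda>j. round (\<xi> $ j)"
  let ?R = "\<Prod>j\<in>UNIV - {i}. bump (c j) (\<xi> $ j - of_int (?k j))"
  have split: "e ?k * (\<Prod>j\<in>UNIV. f j) = e ?k * (f i * (\<Prod>j\<in>UNIV - {i}. f j))" for f :: "'n \<Rightarrow> real"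
    by (simp add: prod.remove[of UNIV i])
  have "((\<lambda>t. bump (c i) (\<xi> $ i + t - of_int (?k i))) has_real_derivative
      bump (Suc (c i)) (\<xi> $ i + 0 - of_int (?k i)) * 1) (at 0)"
    by (rule DERIV_chain2[OF bump_has_derivative]) (auto intro!: derivative_eq_intros)
  then have "((\<lambda>t. e ?k * (bump (c i) (\<xi> $ i + t - of_int (?k i)) * ?R)) has_real_derivative
      e ?k * (bump (Suc (c i)) (\<xi> $ i - of_int (?k i)) * ?R)) (at 0)"
    by (auto intro!: derivative_eq_intros)
  then have "((\<lambda>t. lattice_symbol c e (\<xi> + t *\<^sub>R axis i 1)) has_real_derivative
      e ?k * (bump (Suc (c i)) (\<xi> $ i - of_int (?k i)) * ?R)) (at 0)"
  proof (rule has_field_derivative_transform_within_open[of _ _ _ "ball 0 (1/4)"])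
    fix t :: real
    assume t: "t \<in> ball 0 (1 / 4)"
    have "dist \<xi> (\<xi> + t *\<^sub>R axis i 1) < 1 / 4"
      using t by (simp add: dist_norm)
    moreover have "(\<Prod>j\<in>UNIV - {i}. bump (c j) ((\<xi> + t *\<^sub>R axis i 1) $ j - of_int (?k j))) = ?R"
      by (rule prod.cong) (auto simp: axis_def)
    ultimately show "e ?k * (bump (c i) (\<xi> $ i + t - of_int (?k i)) * ?R) =
        lattice_symbol c e (\<xi> + t *\<^sub>R axis i 1)"
      by (subst lattice_symbol_local[of \<xi>]) (auto simp: split axis_def)
  qed auto
  moreover have "(\<Prod>j\<in>UNIV - {i}. bump ((c(i := Suc (c i))) j) (\<xi> $ j - of_int (?k j))) = ?R"
    by (rule prod.cong) auto
  ultimately show "partial i (lattice_symbol c e) \<xi> = lattice_symbol (c(i := Suc (c i))) e \<xi>"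
    unfolding partial_def lattice_symbol_def[of "c(i := Suc (c i))"] split
    by (simp add: DERIV_imp_deriv)
qed

lemma partials_lattice_symbol: "\<exists>c'. partials is (lattice_symbol c e) = lattice_symbol c' e"
  by (induction "is") (auto simp: partials_def partial_lattice_symbol)

lemma lattice_symbol_bounded:
  fixes c :: "'n::finite \<Rightarrow> nat"
  assumes "\<And>k. \<bar>e k\<bar> \<le> 1"
  shows "\<exists>B\<ge>0. \<forall>\<xi>. \<bar>lattice_symbol c e \<xi>\<bar> \<le> B"
proof -
  obtain B where B: "\<And>k x. \<bar>bump k x\<bar> \<le> B k"
    using bump_bounded by metis
  have "\<bar>lattice_symbol c e \<xi>\<bar> \<le> 1 * (\<Prod>j\<in>UNIV. B (c j))" for \<xi>
    unfolding lattice_symbol_def abs_mult abs_prod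
    by (intro mult_mono assms prod_mono) (auto simp: B intro!: prod_nonneg)
  moreover have "0 \<le> (\<Prod>j\<in>UNIV. B (c j))"
    using B abs_ge_zero order_trans by (intro prod_nonneg) blast
  ultimately show ?thesis
    by auto
qed

text \<open>The symbol and all its derivatives vanish at distance more than \<open>R'\<close> from
  \<Gamma>. Within that distance \<open>(R' / dist)^s\<close> is at least 1, so plain boundedness of
  the derivatives already has the required form.\<close>

lemma lattice_symbol_adapted:
  fixes \<Gamma> :: "(real ^ 'n::{finite,linorder}) set"
  assumes sub: "subspace \<Gamma>" and e: "\<And>k. \<bar>e k\<bar> \<le> 1"
    and near: "\<And>k. e k \<noteq> 0 \<Longrightarrow> infdist (\<chi> j. of_int (k j)) \<Gamma> \<le> R"
  shows "lattice_symbol c e \<in> adapted_symbols \<Gamma>"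
proof -
  define R' where "R' = R + real CARD('n)"
  have supp: "infdist \<xi> \<Gamma> \<le> R'" if "lattice_symbol c' e \<xi> \<noteq> 0" for c' \<xi>
  proof -
    let ?k = "(\<chi> j. of_int (round (\<xi> $ j))) :: (real, 'n) vec"
    have "infdist ?k \<Gamma> \<le> R"
      using that by (intro near) (auto simp: lattice_symbol_def)
    moreover have "dist \<xi> ?k \<le> (\<Sum>j\<in>UNIV. \<bar>(\<xi> - ?k) $ j\<bar>)"
      unfolding dist_norm by (rule norm_le_l1_cart)
    moreover have "(\<Sum>j\<in>UNIV. \<bar>(\<xi> - ?k) $ j\<bar>) \<le> (\<Sum>j\<in>(UNIV::'n set). 1)"
    proof (rule sum_mono)
      fix j :: 'n
      have "\<bar>\<xi> $ j - of_int (round (\<xi> $ j))\<bar> \<le> 1 / 2"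
        using of_int_round_abs_le[of "\<xi> $ j"] by (simp add: abs_minus_commute)
      then show "\<bar>(\<xi> - ?k) $ j\<bar> \<le> 1"
        by simp
    qed
    ultimately show ?thesis
      using infdist_triangle[of \<xi> \<Gamma> ?k] by (simp add: R'_def)
  qed
  have "\<exists>C. \<forall>\<xi>. \<xi> \<notin> \<Gamma> \<longrightarrow>
      \<bar>multi_partial \<gamma> (lattice_symbol c e) \<xi>\<bar> \<le> C * inverse (infdist \<xi> \<Gamma> ^ (\<Sum>i\<in>UNIV. \<gamma> i))" for \<gamma>
  proof -
    let ?s = "\<Sum>i\<in>UNIV. \<gamma> i"
    obtain c' where c': "multi_partial \<gamma> (lattice_symbol c e) = lattice_symbol c' e"
      unfolding multi_partial_def using partials_lattice_symbol by blast
    obtain B where B: "B \<ge> 0" "\<And>\<xi>. \<bar>lattice_symbol c' e \<xi>\<bar> \<le> B"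
      using lattice_symbol_bounded[of e c'] e by blast
    have "\<bar>lattice_symbol c' e \<xi>\<bar> \<le> B * \<bar>R'\<bar> ^ ?s * inverse (infdist \<xi> \<Gamma> ^ ?s)" if "\<xi> \<notin> \<Gamma>" for \<xi>
    proof (cases "lattice_symbol c' e \<xi> = 0")
      case False
      have "0 \<in> \<Gamma>"
        using sub by (rule subspace_0)
      then have pos: "0 < infdist \<xi> \<Gamma>"
        using that infdist_pos_not_in_closed[OF closed_subspace[OF sub]] by blast
      have "infdist \<xi> \<Gamma> \<le> \<bar>R'\<bar>"
        using supp[OF False] by linarith
      then have "infdist \<xi> \<Gamma> ^ ?s \<le> \<bar>R'\<bar> ^ ?s"
        using pos by (intro power_mono) auto
      then have "1 \<le> \<bar>R'\<bar> ^ ?s * inverse (infdist \<xi> \<Gamma> ^ ?s)"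
        using pos by (simp add: field_simps)
      then have "B * 1 \<le> B * (\<bar>R'\<bar> ^ ?s * inverse (infdist \<xi> \<Gamma> ^ ?s))"
        using B(1) by (intro mult_left_mono)
      then show ?thesis
        using B(2)[of \<xi>] by (simp add: mult_ac)
    qed (use B(1) in \<open>simp add: infdist_nonneg\<close>)
    then show ?thesis
      unfolding c' by blast
  qed
  moreover have "smooth_on (- \<Gamma>) (lattice_symbol c e)"
    unfolding smooth_on_def using partials_lattice_symbol lattice_symbol_differentiable by metis
  ultimately show ?thesis
    by (simp add: adapted_symbols_def)
qed

lemma lattice_symbol_at_lattice:
  "lattice_symbol (\<lambda>_. 0) e (\<chi> j. of_int (k j)) = e k"
  by (simp add: lattice_symbol_def bump_0_0)


subsection \<open>The Rudin--Shapiro sequence\<close>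

text \<open>The sign is the parity of the number of adjacent pairs of ones in the binary expansion:
  an odd \<open>n\<close> contributes a factor -1 exactly when \<open>n div 2\<close> is odd
  too.\<close>

fun rudin_shapiro :: "nat \<Rightarrow> real" where
  "rudin_shapiro n =
     (if n = 0 then 1 else (if even n then 1 else (-1) ^ (n div 2)) * rudin_shapiro (n div 2))"

declare rudin_shapiro.simps [simp del]

lemma rudin_shapiro_0: "rudin_shapiro 0 = 1"
  by (simp add: rudin_shapiro.simps)

lemma rudin_shapiro_double: "rudin_shapiro (2 * n) = rudin_shapiro n"
  by (cases "n = 0") (simp_all add: rudin_shapiro_0, simp add: rudin_shapiro.simps[of "2 * n"])

lemma rudin_shapiro_Suc_double: "rudin_shapiro (2 * n + 1) = (-1) ^ n * rudin_shapiro n"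
  by (subst rudin_shapiro.simps) simp

lemma abs_rudin_shapiro: "\<bar>rudin_shapiro n\<bar> = 1"
proof (induction n rule: less_induct)
  case (less n)
  then show ?case
    by (cases "n = 0") (simp_all add: rudin_shapiro_0 rudin_shapiro.simps[of n] abs_mult power_abs)
qed

definition rudin_shapiro_poly :: "nat \<Rightarrow> complex \<Rightarrow> complex" where
  "rudin_shapiro_poly k z = (\<Sum>l<2 ^ k. of_real (rudin_shapiro l) * z ^ l)"

text \<open>Splitting the indices by parity: the sign \<open>(-1)^l\<close> attached to the odd
  index \<open>2 l + 1\<close> turns \<open>z^2\<close> into \<open>-z^2\<close>.\<close>

lemma rudin_shapiro_poly_Suc:
  "rudin_shapiro_poly (Suc k) z = rudin_shapiro_poly k (z\<^sup>2) + z * rudin_shapiro_poly k (- z\<^sup>2)"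
proof -
  have split: "(\<Sum>l<2 * n. f l) = (\<Sum>l<n. f (2 * l)) + (\<Sum>l<n. f (2 * l + 1))"
    for f :: "nat \<Rightarrow> complex" and n
    by (induction n) (auto simp: algebra_simps)
  have "(\<Sum>l<2 ^ k. of_real (rudin_shapiro (2 * l)) * z ^ (2 * l)) = rudin_shapiro_poly k (z\<^sup>2)"
    unfolding rudin_shapiro_poly_def rudin_shapiro_double by (simp add: power_mult)
  moreover have "(\<Sum>l<2 ^ k. of_real (rudin_shapiro (2 * l + 1)) * z ^ (2 * l + 1)) =
      z * rudin_shapiro_poly k (- z\<^sup>2)"
    unfolding rudin_shapiro_poly_def rudin_shapiro_Suc_double sum_distrib_left
  proof (rule sum.cong)
    fix l
    have "(- z\<^sup>2) ^ l = (-1) ^ l * z ^ (2 * l)"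
      by (subst power_minus) (simp add: power_mult)
    then show "of_real ((-1) ^ l * rudin_shapiro l) * z ^ (2 * l + 1) =
        z * (of_real (rudin_shapiro l) * (- z\<^sup>2) ^ l)"
      by simp
  qed simp
  ultimately show ?thesis
    using split[of "\<lambda>l. of_real (rudin_shapiro l) * z ^ l" "2 ^ k"]
    by (simp add: rudin_shapiro_poly_def[of "Suc k"])
qed

text \<open>The parallelogram law makes the sum over \<open>z\<close> and \<open>-z\<close> exactly double in each step.\<close>

lemma rudin_shapiro_poly_parallelogram:
  assumes "cmod z = 1"
  shows "(cmod (rudin_shapiro_poly k z))\<^sup>2 + (cmod (rudin_shapiro_poly k (- z)))\<^sup>2 = 2 * 2 ^ k"
  using assms
proof (induction k arbitrary: z)
  case 0
  then show ?case
    by (simp add: rudin_shapiro_poly_def rudin_shapiro_0)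
next
  case (Suc k)
  have par: "(cmod (a + b))\<^sup>2 + (cmod (a + - b))\<^sup>2 = 2 * ((cmod a)\<^sup>2 + (cmod b)\<^sup>2)" for a b
    unfolding cmod_power2 by (simp add: algebra_simps power2_eq_square)
  have z: "cmod (z\<^sup>2) = 1"
    using Suc.prems by (simp add: norm_power)
  have "(cmod (rudin_shapiro_poly (Suc k) z))\<^sup>2 + (cmod (rudin_shapiro_poly (Suc k) (- z)))\<^sup>2 =
      2 * ((cmod (rudin_shapiro_poly k (z\<^sup>2)))\<^sup>2 + (cmod (z * rudin_shapiro_poly k (- z\<^sup>2)))\<^sup>2)"
    unfolding rudin_shapiro_poly_Suc par[symmetric] by simp
  then show ?case
    using Suc.IH[OF z] Suc.prems by (simp add: norm_mult)
qed

lemma rudin_shapiro_poly_bound: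
  assumes "cmod z = 1"
  shows "cmod (rudin_shapiro_poly k z) \<le> sqrt (2 * 2 ^ k)"
  using rudin_shapiro_poly_parallelogram[OF assms, of k]
  by (intro real_le_rsqrt) (smt (verit) zero_le_power2)

text \<open>An even extension to the integers, since a nonzero lattice point with zero coordinate
  sum has coordinates of both signs.\<close>

definition rs_coeff :: "int \<Rightarrow> real" where
  "rs_coeff l = rudin_shapiro (nat \<bar>l\<bar>)"

lemma abs_rs_coeff: "\<bar>rs_coeff l\<bar> = 1"
  by (simp add: rs_coeff_def abs_rudin_shapiro)

definition rs_range :: "nat \<Rightarrow> int set" where
  "rs_range K = {- (2 ^ K) <..< 2 ^ K}"

lemma finite_rs_range: "finite (rs_range K)"
  by (simp add: rs_range_def)

text \<open>The non-negative and the non-positive frequencies give the Rudin-Shapiro polynomial at a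
  point of the circle and at its conjugate, with the term at 0 counted twice. The constant comes
  from \<open>2 * sqrt 2 + 1 <= 4\<close>.\<close>

lemma rs_coeff_sum_bound:
  "cmod (\<Sum>l\<in>rs_range K. of_real (rs_coeff l) * cis (2 * pi * of_int l * x)) \<le> 4 * sqrt (2 ^ K)"
proof -
  let ?f = "\<lambda>l. of_real (rs_coeff l) * cis (2 * pi * of_int l * x)"
  let ?A = "int ` {..<2 ^ K}" and ?B = "(\<lambda>l. - int l) ` {..<2 ^ K}"
  let ?z = "cis (2 * pi * x)"
  have "rs_range K = ?A \<union> ?B"
  proof (intro equalityI subsetI)
    fix l assume l: "l \<in> rs_range K"
    show "l \<in> ?A \<union> ?B"
    proof (cases "0 \<le> l")
      case True
      have "l = int (nat l)" "nat l < 2 ^ K"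
        using True l by (auto simp: rs_range_def nat_less_iff)
      then show ?thesis
        by blast
    next
      case False
      have "l = - int (nat (- l))" "nat (- l) < 2 ^ K"
        using False l by (auto simp: rs_range_def nat_less_iff)
      then show ?thesis
        by blast
    qed
  next
    fix l assume "l \<in> ?A \<union> ?B"
    then obtain j where j: "j < 2 ^ K" "l = int j \<or> l = - int j"
      by blast
    have "int j < 2 ^ K"
      using j(1) by (metis of_nat_less_iff of_nat_numeral of_nat_power)
    then have "- (2 ^ K) < int j" "- int j < 2 ^ K"
      using of_nat_0_le_iff[of j, where 'a=int] by linarith+
    with \<open>int j < 2 ^ K\<close> show "l \<in> rs_range K"
      using j(2) by (auto simp: rs_range_def)
  qed
  moreover have "?A \<inter> ?B = {0}"
    by (auto simp: image_iff)
  ultimately have "sum ?f (rs_range K) = sum ?f ?A + sum ?f ?B - ?f 0"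
    by (simp add: sum_Un)
  moreover have "sum ?f ?A = rudin_shapiro_poly K ?z"
  proof -
    have "?f (int l) = of_real (rudin_shapiro l) * ?z ^ l" for l
      unfolding Complex.DeMoivre by (simp add: rs_coeff_def mult_ac)
    then show ?thesis
      by (simp add: rudin_shapiro_poly_def sum.reindex inj_on_def)
  qed
  moreover have "sum ?f ?B = rudin_shapiro_poly K (cnj ?z)"
  proof -
    have "?f (- int l) = of_real (rudin_shapiro l) * cnj ?z ^ l" for l
      unfolding cis_cnj Complex.DeMoivre by (simp add: rs_coeff_def mult_ac)
    then show ?thesis
      by (simp add: rudin_shapiro_poly_def sum.reindex inj_on_def)
  qed
  ultimately have eq: "sum ?f (rs_range K) = rudin_shapiro_poly K ?z + rudin_shapiro_poly K (cnj ?z) - ?f 0"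
    by simp
  have "cmod (sum ?f (rs_range K)) \<le>
      cmod (rudin_shapiro_poly K ?z) + cmod (rudin_shapiro_poly K (cnj ?z)) + cmod (?f 0)"
    unfolding eq using norm_triangle_ineq4[of "rudin_shapiro_poly K ?z + rudin_shapiro_poly K (cnj ?z)" "?f 0"]
      norm_triangle_ineq[of "rudin_shapiro_poly K ?z" "rudin_shapiro_poly K (cnj ?z)"] by linarith
  also have "\<dots> \<le> sqrt (2 * 2 ^ K) + sqrt (2 * 2 ^ K) + 1"
    by (intro add_mono rudin_shapiro_poly_bound) (auto simp: abs_rs_coeff)
  also have "\<dots> \<le> 4 * sqrt (2 ^ K)"
  proof -
    have "sqrt 2 \<le> 3 / 2"
      by (rule real_le_lsqrt) (auto simp: power2_eq_square)
    then have "sqrt (2 * 2 ^ K) \<le> 3 / 2 * sqrt (2 ^ K)"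
      unfolding real_sqrt_mult by (intro mult_right_mono) auto
    moreover have "1 \<le> sqrt ((2::real) ^ K)"
      by simp
    ultimately show ?thesis
      by linarith
  qed
  finally show ?thesis .
qed


subsection \<open>Gaussian wave packets\<close>

text \<open>A complex variable makes the derivative rules for fields available; the functions of
  interest are the restrictions to the real line. The polynomial factor makes the class closed under
  differentiation with \<open>b\<close> and \<open>c\<close> unchanged.\<close>

definition gauss_poly :: "complex poly \<Rightarrow> complex \<Rightarrow> real \<Rightarrow> complex \<Rightarrow> complex" where
  "gauss_poly P b c z = poly P z * exp (b * z - of_real c * z\<^sup>2)"

lemma gauss_poly_has_vector_derivative:
  "((\<lambda>x. gauss_poly P b c (of_real x)) has_vector_derivative
     gauss_poly (pderiv P + P * [:b, - 2 * of_real c:]) b c (of_real x)) (at x)"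
proof -
  have "(gauss_poly P b c has_field_derivative
     gauss_poly (pderiv P + P * [:b, - 2 * of_real c:]) b c z) (at z)" for z
    unfolding gauss_poly_def
    by (rule derivative_eq_intros refl poly_DERIV)+ (simp add: algebra_simps)
  then show ?thesis
    by (rule has_vector_derivative_real_field)
qed

text \<open>The power \<open>m\<close> is arbitrary in the induction because each coefficient split
  off trades a factor \<open>x\<close> of the polynomial for one more power.\<close>

lemma power_poly_bound:
  fixes P :: "complex poly"
  shows "\<exists>C. \<forall>x::real. \<bar>x\<bar> ^ m * norm (poly P (of_real x)) \<le> C * exp \<bar>x\<bar>"
proof (induction P arbitrary: m)
  case 0
  show ?case
    by (auto intro!: exI[of _ 0])
next
  case (pCons a P)
  obtain C where C: "\<And>x::real. \<bar>x\<bar> ^ Suc m * norm (poly P (of_real x)) \<le> C * exp \<bar>x\<bar>"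
    using pCons.IH by blast
  have "\<bar>x\<bar> ^ m * norm (poly (pCons a P) (of_real x)) \<le> (fact m * norm a + C) * exp \<bar>x\<bar>" for x :: real
  proof -
    have "\<bar>x\<bar> ^ m * norm (poly (pCons a P) (of_real x)) \<le>
        \<bar>x\<bar> ^ m * (norm a + \<bar>x\<bar> * norm (poly P (of_real x)))"
      by (intro mult_left_mono) (auto intro: norm_triangle_le simp: norm_mult)
    also have "\<dots> = \<bar>x\<bar> ^ m * norm a + \<bar>x\<bar> ^ Suc m * norm (poly P (of_real x))"
      by (simp add: algebra_simps)
    also have "\<dots> \<le> fact m * exp \<bar>x\<bar> * norm a + C * exp \<bar>x\<bar>"
      by (intro add_mono C mult_right_mono power_le_fact_exp) auto
    finally show ?thesis
      by (simp add: algebra_simps)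
  qed
  then show ?case
    by blast
qed

lemma gauss_poly_decay:
  assumes "0 < c"
  shows "\<exists>C. \<forall>x::real. \<bar>x\<bar> ^ m * norm (gauss_poly P b c (of_real x)) \<le> C"
proof -
  obtain C where C: "\<And>x::real. \<bar>x\<bar> ^ m * norm (poly P (of_real x)) \<le> C * exp \<bar>x\<bar>"
    using power_poly_bound by blast
  have C0: "0 \<le> C"
    using order_trans[OF _ C[of 0]] by simp
  \<comment> \<open>The summand 1 pays for the factor \<open>exp \<bar>x\<bar>\<close> that bounds
    the polynomial; completing the square then gives the final constant.\<close>
  define B where "B = 1 + \<bar>Re b\<bar>"
  have "\<bar>x\<bar> ^ m * norm (gauss_poly P b c (of_real x)) \<le> C * exp (B\<^sup>2 / (4 * c))" for x :: real
  proof -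
    have "\<bar>x\<bar> ^ m * norm (gauss_poly P b c (of_real x)) =
        (\<bar>x\<bar> ^ m * norm (poly P (of_real x))) * exp (Re b * x - c * x\<^sup>2)"
      by (simp add: gauss_poly_def norm_mult flip: of_real_power)
    also have "\<dots> \<le> (C * exp \<bar>x\<bar>) * exp (Re b * x - c * x\<^sup>2)"
      by (intro mult_right_mono C) auto
    also have "\<dots> = C * exp (\<bar>x\<bar> + (Re b * x - c * x\<^sup>2))"
      by (simp add: exp_add)
    also have "\<dots> \<le> C * exp (B\<^sup>2 / (4 * c))"
    proof -
      have "Re b * x \<le> \<bar>Re b\<bar> * \<bar>x\<bar>"
        by (metis abs_ge_self abs_mult)
      then have "\<bar>x\<bar> + (Re b * x - c * x\<^sup>2) \<le> B * \<bar>x\<bar> - c * \<bar>x\<bar>\<^sup>2"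
        by (simp add: B_def algebra_simps)
      also have "\<dots> = B\<^sup>2 / (4 * c) - c * (\<bar>x\<bar> - B / (2 * c))\<^sup>2"
        using assms by (simp add: power2_eq_square field_simps)
      also have "\<dots> \<le> B\<^sup>2 / (4 * c)"
        using assms by simp
      finally show ?thesis
        using C0 by (intro mult_left_mono) auto
    qed
    finally show ?thesis .
  qed
  then show ?thesis
    by blast
qed

lemma schwartz_gauss_sum:
  assumes "finite L" "0 < c"
  shows "(\<lambda>x. \<Sum>l\<in>L. gauss_poly (P l) (b l) c (of_real x)) \<in> schwartz"
proof -
  let ?f = "\<lambda>P x. \<Sum>l\<in>L. gauss_poly (P l) (b l) c (of_real x)"
  have deriv: "(?f P has_vector_derivative
      ?f (\<lambda>l. pderiv (P l) + P l * [:b l, - 2 * of_real c:]) x) (at x)" for P x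
    by (intro has_vector_derivative_sum gauss_poly_has_vector_derivative)
  have nth: "\<exists>Q. nth_derivative k (?f P) = ?f Q" for k
  proof (induction k)
    case (Suc k)
    then obtain Q where "nth_derivative k (?f P) = ?f Q"
      by blast
    then have "nth_derivative (Suc k) (?f P) = (\<lambda>x. vector_derivative (?f Q) (at x))"
      by (simp add: nth_derivative_def)
    then show ?case
      using vector_derivative_at[OF deriv[of Q]] by auto
  qed (auto simp: nth_derivative_def)
  have bound: "\<exists>C. \<forall>x. \<bar>x\<bar> ^ m * norm (?f Q x) \<le> C" for Q m
  proof -
    have "\<forall>l. \<exists>C. \<forall>x. \<bar>x\<bar> ^ m * norm (gauss_poly (Q l) (b l) c (of_real x)) \<le> C"
      using gauss_poly_decay[OF assms(2)] by blast
    then obtain C where C: "\<And>l x. \<bar>x\<bar> ^ m * norm (gauss_poly (Q l) (b l) c (of_real x)) \<le> C l"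
      by metis
    have "\<bar>x\<bar> ^ m * norm (?f Q x) \<le> (\<Sum>l\<in>L. C l)" for x
    proof -
      have "\<bar>x\<bar> ^ m * norm (?f Q x) \<le> \<bar>x\<bar> ^ m * (\<Sum>l\<in>L. norm (gauss_poly (Q l) (b l) c (of_real x)))"
        by (intro mult_left_mono norm_sum) auto
      also have "\<dots> \<le> (\<Sum>l\<in>L. C l)"
        unfolding sum_distrib_left by (intro sum_mono C)
      finally show ?thesis .
    qed
    then show ?thesis
      by blast
  qed
  have diff: "?f Q differentiable (at x)" for Q x
    using deriv[of Q x] by (auto simp: differentiable_def has_vector_derivative_def)
  show ?thesis
    unfolding schwartz_def
  proof (intro CollectI conjI allI)
    fix k x
    show "nth_derivative k (?f P) differentiable (at x)"
      using nth[of k] diff by metis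
  next
    fix k m
    show "\<exists>C. \<forall>x. \<bar>x\<bar> ^ m * norm (nth_derivative k (?f P) x) \<le> C"
      using nth[of k] bound by metis
  qed
qed

lemma borel_measurable_cis [measurable]: "cis \<in> borel_measurable borel"
  by (intro borel_measurable_continuous_onI continuous_intros)

text \<open>The parameter \<sigma> is the width on the frequency side: the Gaussian is scaled so
  that its Fourier transform is the probability density \<open>normal_density 0 \<sigma>\<close>.
  Small \<sigma> means a wide packet.\<close>

definition rs_packet :: "nat \<Rightarrow> real \<Rightarrow> real \<Rightarrow> complex" where
  "rs_packet K \<sigma> x =
     (\<Sum>l\<in>rs_range K. of_real (rs_coeff l) * cis (2 * pi * of_int l * x)) * of_real (exp (- (2 * pi * \<sigma> * x)\<^sup>2 / 2))"

lemma rs_packet_schwartz: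
  assumes "\<sigma> \<noteq> 0"
  shows "rs_packet K \<sigma> \<in> schwartz"
proof -
  have "rs_packet K \<sigma> = (\<lambda>x. \<Sum>l\<in>rs_range K.
      gauss_poly [:of_real (rs_coeff l):] (2 * pi * of_int l * \<i>) ((2 * pi * \<sigma>)\<^sup>2 / 2) (of_real x))"
    unfolding rs_packet_def sum_distrib_right gauss_poly_def
    by (intro ext sum.cong refl)
      (simp add: cis_conv_exp exp_of_real[symmetric] exp_add[symmetric] exp_diff power_mult_distrib mult_ac flip: of_real_power)
  then show ?thesis
    using assms by (simp add: schwartz_gauss_sum finite_rs_range)
qed

lemma norm_rs_packet:
  "norm (rs_packet K \<sigma> x) \<le> 4 * sqrt (2 ^ K) * exp (- (2 * pi * \<sigma> * x)\<^sup>2 / 2)"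
  unfolding rs_packet_def norm_mult using rs_coeff_sum_bound[where K=K and x=x]
  by (auto intro!: mult_right_mono)

lemma continuous_rs_packet: "continuous_on UNIV (rs_packet K \<sigma>)"
  unfolding rs_packet_def by (intro continuous_intros) auto

text \<open>Both claims follow from the characteristic function of the standard normal distribution
  by rescaling with \<open>s\<close>.\<close>

lemma integral_gauss_cis:
  assumes "0 < s"
  shows "(LINT x|lborel. of_real (exp (- (s * x)\<^sup>2 / 2)) * cis (t * x)) =
    complex_of_real (sqrt (2 * pi) / s * exp (- (t / s)\<^sup>2 / 2))"
    and "integrable lborel (\<lambda>x. complex_of_real (exp (- (s * x)\<^sup>2 / 2)) * cis (t * x))"
proof -
  let ?g = "\<lambda>t x. complex_of_real (exp (- x\<^sup>2 / 2)) * cis (t * x)"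
  have g: "?g t = (\<lambda>x. sqrt (2 * pi) * (std_normal_density x *\<^sub>R cis (t * x)))" for t
    by (auto simp: std_normal_density_def scaleR_conv_of_real real_sqrt_mult field_simps simp flip: of_real_mult)
  have "integrable std_normal_distribution (\<lambda>x. cis (t * x))" for t
    using prob_space.finite_measure[OF prob_space_normal_density[of 1 0]]
    by (intro finite_measure.integrable_const_bound[where B=1]) auto
  then have int: "integrable lborel (\<lambda>x. std_normal_density x *\<^sub>R cis (t * x))" for t
    by (subst (asm) integrable_density) (auto simp: normal_density_nonneg)
  then have int': "integrable lborel (?g t)" for t
    unfolding g by (intro integrable_mult_right)
  have "char std_normal_distribution t = (LINT x|lborel. std_normal_density x *\<^sub>R cis (t * x))" for t
    unfolding char_def by (subst integral_density) (auto simp: normal_density_nonneg cis_conv_exp)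
  then have val: "(LINT x|lborel. ?g t x) = sqrt (2 * pi) * exp (- t\<^sup>2 / 2)" for t
    unfolding g integral_mult_right_zero by (simp add: char_std_normal_distribution)
  have sub: "(\<lambda>x. complex_of_real (exp (- (s * x)\<^sup>2 / 2)) * cis (t * x)) = (\<lambda>x. ?g (t / s) (0 + s * x))"
    using assms by simp
  show "integrable lborel (\<lambda>x. complex_of_real (exp (- (s * x)\<^sup>2 / 2)) * cis (t * x))"
    unfolding sub by (rule lborel_integrable_real_affine[OF int']) (use assms in simp)
  have "(LINT x|lborel. ?g (t / s) x) = s *\<^sub>R (LINT x|lborel. ?g (t / s) (0 + s * x))"
    using lborel_integral_real_affine[of s "?g (t / s)" 0] assms by simp
  then show "(LINT x|lborel. of_real (exp (- (s * x)\<^sup>2 / 2)) * cis (t * x)) =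
    complex_of_real (sqrt (2 * pi) / s * exp (- (t / s)\<^sup>2 / 2))"
    unfolding sub val using assms by (simp add: scaleR_conv_of_real field_simps)
qed

lemma fourier_rs_packet:
  assumes "0 < \<sigma>"
  shows "fourier (rs_packet K \<sigma>) \<xi> =
    (\<Sum>l\<in>rs_range K. of_real (rs_coeff l * normal_density (of_int l) \<sigma> \<xi>))"
proof -
  let ?s = "2 * pi * \<sigma>"
  let ?t = "\<lambda>l. - 2 * pi * (\<xi> - of_int l)"
  let ?e = "\<lambda>x. complex_of_real (exp (- (?s * x)\<^sup>2 / 2))"
  have s: "0 < ?s"
    using assms by simp
  have "rs_packet K \<sigma> \<in> borel_measurable lborel"
    using borel_measurable_continuous_onI[OF continuous_rs_packet] by simp
  moreover have "(\<lambda>x. cis (- 2 * pi * x * \<xi>)) \<in> borel_measurable lborel"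
    by measurable
  ultimately have "fourier (rs_packet K \<sigma>) \<xi> = (LINT x|lborel. rs_packet K \<sigma> x * cis (- 2 * pi * x * \<xi>))"
    unfolding fourier_def by (subst integral_completion) auto
  also have "\<dots> = (LINT x|lborel. (\<Sum>l\<in>rs_range K. of_real (rs_coeff l) * (?e x * cis (?t l * x))))"
    unfolding rs_packet_def sum_distrib_right
    by (intro Bochner_Integration.integral_cong sum.cong refl) (simp add: cis_mult mult_ac algebra_simps)
  also have "\<dots> = (\<Sum>l\<in>rs_range K. LINT x|lborel. of_real (rs_coeff l) * (?e x * cis (?t l * x)))"
    by (rule Bochner_Integration.integral_sum) (intro integrable_mult_right integral_gauss_cis(2)[OF s])
  also have "\<dots> = (\<Sum>l\<in>rs_range K. of_real (rs_coeff l) * (LINT x|lborel. ?e x * cis (?t l * x)))"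
    by simp
  also have "\<dots> = (\<Sum>l\<in>rs_range K. of_real (rs_coeff l * normal_density (of_int l) \<sigma> \<xi>))"
  proof (rule sum.cong)
    fix l
    have "sqrt (2 * pi) / ?s * exp (- (?t l / ?s)\<^sup>2 / 2) = normal_density (of_int l) \<sigma> \<xi>"
    proof -
      have "sqrt (2 * pi) / ?s = 1 / sqrt (2 * pi * \<sigma>\<^sup>2)"
        using assms by (simp add: real_sqrt_mult field_simps)
      moreover have "- (?t l / ?s)\<^sup>2 / 2 = - (\<xi> - of_int l)\<^sup>2 / (2 * \<sigma>\<^sup>2)"
        using assms by (simp add: power2_eq_square field_simps)
      ultimately show ?thesis
        by (simp add: normal_density_def)
    qed
    then show "of_real (rs_coeff l) * (LINT x|lborel. ?e x * cis (?t l * x)) =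
        complex_of_real (rs_coeff l * normal_density (of_int l) \<sigma> \<xi>)"
      unfolding integral_gauss_cis(1)[OF s] by simp
  qed simp
  finally show ?thesis .
qed


subsection \<open>Transference to the lattice\<close>

lemma nn_integral_cart_prod:
  fixes f :: "'n::finite \<Rightarrow> real \<Rightarrow> ennreal"
  assumes [measurable]: "\<And>j. f j \<in> borel_measurable borel"
  shows "(\<integral>\<^sup>+\<xi>. (\<Prod>j\<in>UNIV. f j (\<xi> $ j)) \<partial>lborel) = (\<Prod>j\<in>UNIV. \<integral>\<^sup>+x. f j x \<partial>lborel)"
proof -
  let ?a = "\<lambda>j::'n. axis j (1::real)"
  have inj: "inj ?a"
    by (auto simp: inj_def axis_eq_axis)
  have B: "Basis = range ?a"
    by (auto simp: Basis_vec_def)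
  let ?f = "\<lambda>b. f (inv ?a b)"
  have "(\<integral>\<^sup>+\<xi>. (\<Prod>b\<in>Basis. ?f b (\<xi> \<bullet> b)) \<partial>lborel) = (\<Prod>b\<in>Basis. \<integral>\<^sup>+x. ?f b x \<partial>lborel)"
    by (rule nn_integral_lborel_prod) auto
  then show ?thesis
    by (simp add: B prod.reindex[OF inj] inv_f_f[OF inj] inner_axis)
qed

lemma has_bochner_integral_normal_product:
  fixes \<mu> :: "'n::finite \<Rightarrow> real"
  assumes "0 < \<sigma>"
  shows "has_bochner_integral lborel (\<lambda>\<xi>::real^'n. \<Prod>j\<in>UNIV. normal_density (\<mu> j) \<sigma> (\<xi> $ j)) 1"
proof (rule has_bochner_integral_nn_integral)
  have "(\<integral>\<^sup>+x. ennreal (normal_density (\<mu> j) \<sigma> x) \<partial>lborel) = 1" for j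
    using nn_integral_eq_integral[OF integrable_normal_density[OF assms, of "\<mu> j"]] assms
    by (simp add: normal_density_nonneg)
  then show "(\<integral>\<^sup>+\<xi>. ennreal (\<Prod>j\<in>UNIV. normal_density (\<mu> j) \<sigma> (\<xi> $ j)) \<partial>lborel) = ennreal 1"
    using nn_integral_cart_prod[of "\<lambda>j x. ennreal (normal_density (\<mu> j) \<sigma> x)"]
    by (simp add: prod_ennreal[symmetric])
qed (auto intro!: prod_nonneg)

lemma lborel_integral_affine:
  fixes f :: "'a::euclidean_space \<Rightarrow> 'b::{banach, second_countable_topology}"
  assumes "f \<in> borel_measurable borel" "c \<noteq> 0"
  shows "integral\<^sup>L lborel f = \<bar>c\<bar> ^ DIM('a) *\<^sub>R (LINT x|lborel. f (t + c *\<^sub>R x))"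
proof -
  have "integral\<^sup>L lborel f =
      integral\<^sup>L (density (distr lborel borel (\<lambda>x. t + c *\<^sub>R x)) (\<lambda>_. ennreal (\<bar>c\<bar> ^ DIM('a)))) f"
    using lborel_affine[OF assms(2), of t] by (simp add: ennreal_power)
  also have "\<dots> = \<bar>c\<bar> ^ DIM('a) *\<^sub>R (LINT x|lborel. f (t + c *\<^sub>R x))"
    using assms(1) by (simp add: integral_density integral_distr)
  finally show ?thesis .
qed

definition std_gauss :: "real ^ 'n::finite \<Rightarrow> real" where
  "std_gauss \<eta> = (\<Prod>j\<in>UNIV. std_normal_density (\<eta> $ j))"

lemma std_gauss_nonneg: "0 \<le> std_gauss \<eta>"
  by (auto simp: std_gauss_def intro!: prod_nonneg)

lemma borel_measurable_std_gauss [measurable]: "std_gauss \<in> borel_measurable borel"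
  unfolding std_gauss_def by measurable

lemma integrable_std_gauss: "integrable lborel std_gauss"
  and integral_std_gauss: "integral\<^sup>L lborel std_gauss = 1"
  using has_bochner_integral_normal_product[of 1 "\<lambda>_. 0"]
  by (auto simp: std_gauss_def[abs_def] has_bochner_integral_iff)

lemma integrable_bounded_mult:
  fixes f :: "'a \<Rightarrow> real" and h :: "'a \<Rightarrow> complex"
  assumes "integrable M f" "h \<in> borel_measurable M" "\<And>x. norm (h x) \<le> B"
  shows "integrable M (\<lambda>x. h x * of_real (f x))"
proof (rule Bochner_Integration.integrable_bound)
  show "integrable M (\<lambda>x. B * f x)"
    using assms(1) by simp
  have "norm (h x) \<le> \<bar>B\<bar>" for x
    using assms(3)[of x] by linarith
  then show "AE x in M. norm (h x * complex_of_real (f x)) \<le> norm (B * f x)"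
    by (intro AE_I2) (simp add: norm_mult abs_mult mult_right_mono)
qed (use assms in auto)

lemma prod_cis: "(\<Prod>j\<in>A. cis (f j)) = cis (\<Sum>j\<in>A. f j)"
  by (induction A rule: infinite_finite_induct) (auto simp: cis_mult)

section \<open>The multiplier applied to wave packets\<close>

definition lattice_point :: "('n \<Rightarrow> int) \<Rightarrow> real ^ 'n::finite" where
  "lattice_point k = (\<chi> j. of_int (k j))"

text \<open>The response to packets at the frequencies \<open>k j\<close>, in the rescaled variables
  \<open>\<eta> = (\<xi> - k) / \<sigma>\<close> and \<open>y = \<sigma> x\<close> and without the
  oscillation of frequency \<open>k_1 + ... + k_n\<close>. For fixed \<open>y\<close> and \<sigma>
  tending to 0 a continuous symbol is seen only through its value at \<open>k\<close>.\<close>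

definition wave_integral :: "(real ^ 'n::finite \<Rightarrow> real) \<Rightarrow> ('n \<Rightarrow> int) \<Rightarrow> real \<Rightarrow> real \<Rightarrow> complex" where
  "wave_integral m k \<sigma> y = (LINT \<eta>|lborel.
     of_real (m (lattice_point k + \<sigma> *\<^sub>R \<eta>)) * cis (2 * pi * y * (\<Sum>j\<in>UNIV. \<eta> $ j)) * of_real (std_gauss \<eta>))"

lemma normal_product_integral:
  fixes m :: "real ^ 'n::finite \<Rightarrow> real" and k :: "'n \<Rightarrow> int" and x :: real
  assumes m: "m \<in> borel_measurable borel" "\<And>\<xi>. \<bar>m \<xi>\<bar> \<le> B" and \<sigma>: "0 < \<sigma>"
  defines "g \<equiv> \<lambda>\<xi>::real^'n. of_real (m \<xi>) * (\<Prod>j\<in>UNIV. of_real (normal_density (of_int (k j)) \<sigma> (\<xi> $ j)) * cis (2 * pi * x * \<xi> $ j))"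
  shows "integrable lborel g"
    and "integral\<^sup>L lborel g = cis (2 * pi * x * of_int (\<Sum>j\<in>UNIV. k j)) * wave_integral m k \<sigma> (\<sigma> * x)"
proof -
  let ?p = "\<lambda>\<xi>::real^'n. \<Prod>j\<in>UNIV. normal_density (of_int (k j)) \<sigma> (\<xi> $ j)"
  let ?h = "\<lambda>\<xi>::real^'n. of_real (m \<xi>) * cis (\<Sum>j\<in>UNIV. 2 * pi * x * \<xi> $ j)"
  note m(1) [measurable]
  have g: "g = (\<lambda>\<xi>. ?h \<xi> * of_real (?p \<xi>))"
    unfolding g_def prod.distrib prod_cis by (simp add: mult_ac)
  have "integrable lborel ?p"
    using has_bochner_integral_normal_product[OF \<sigma>, of "\<lambda>j. of_int (k j)"] by (simp add: has_bochner_integral_iff)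
  then show "integrable lborel g"
    unfolding g by (rule integrable_bounded_mult[where B = B]) (use m(2) in \<open>auto simp: norm_mult\<close>)
  have "g \<in> borel_measurable borel"
    unfolding g by measurable
  \<comment> \<open>Substitution of \<open>k + \<sigma> \<eta>\<close> for \<xi>; the Jacobian turns
    the densities of width \<sigma> into standard ones.\<close>
  then have "integral\<^sup>L lborel g = \<bar>\<sigma>\<bar> ^ DIM(real^'n) *\<^sub>R (LINT \<eta>|lborel. g (lattice_point k + \<sigma> *\<^sub>R \<eta>))"
    by (rule lborel_integral_affine) (use \<sigma> in auto)
  also have "\<dots> = (LINT \<eta>|lborel. \<bar>\<sigma>\<bar> ^ DIM(real^'n) *\<^sub>R g (lattice_point k + \<sigma> *\<^sub>R \<eta>))"
    by simp
  also have "\<dots> = (LINT \<eta>|lborel. cis (2 * pi * x * of_int (\<Sum>j\<in>UNIV. k j)) *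
      (of_real (m (lattice_point k + \<sigma> *\<^sub>R \<eta>)) * cis (2 * pi * (\<sigma> * x) * (\<Sum>j\<in>UNIV. \<eta> $ j)) * of_real (std_gauss \<eta>)))"
  proof (rule Bochner_Integration.integral_cong[OF refl])
    fix \<eta> :: "real ^ 'n"
    let ?\<xi> = "lattice_point k + \<sigma> *\<^sub>R \<eta>"
    have "\<sigma> * normal_density (of_int (k j)) \<sigma> (?\<xi> $ j) = std_normal_density (\<eta> $ j)" for j
      using \<sigma> by (simp add: normal_density_def lattice_point_def real_sqrt_mult power_mult_distrib)
    then have "(\<Prod>j\<in>UNIV. \<sigma> * normal_density (of_int (k j)) \<sigma> (?\<xi> $ j)) = std_gauss \<eta>"
      by (simp add: std_gauss_def)
    then have p: "\<bar>\<sigma>\<bar> ^ DIM(real^'n) * ?p ?\<xi> = std_gauss \<eta>"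
      using \<sigma> by (simp add: prod.distrib)
    have "(\<Sum>j\<in>UNIV. 2 * pi * x * ?\<xi> $ j) =
        2 * pi * x * of_int (\<Sum>j\<in>UNIV. k j) + 2 * pi * (\<sigma> * x) * (\<Sum>j\<in>UNIV. \<eta> $ j)"
      by (simp add: lattice_point_def sum.distrib algebra_simps sum_distrib_left)
    then have c: "cis (\<Sum>j\<in>UNIV. 2 * pi * x * ?\<xi> $ j) =
        cis (2 * pi * x * of_int (\<Sum>j\<in>UNIV. k j)) * cis (2 * pi * (\<sigma> * x) * (\<Sum>j\<in>UNIV. \<eta> $ j))"
      by (simp only: cis_mult)
    show "\<bar>\<sigma>\<bar> ^ DIM(real^'n) *\<^sub>R g ?\<xi> = cis (2 * pi * x * of_int (\<Sum>j\<in>UNIV. k j)) *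
      (of_real (m ?\<xi>) * cis (2 * pi * (\<sigma> * x) * (\<Sum>j\<in>UNIV. \<eta> $ j)) * of_real (std_gauss \<eta>))"
      unfolding g c unfolding p[symmetric] scaleR_conv_of_real of_real_mult by (simp only: mult_ac)
  qed
  also have "\<dots> = cis (2 * pi * x * of_int (\<Sum>j\<in>UNIV. k j)) * wave_integral m k \<sigma> (\<sigma> * x)"
    unfolding wave_integral_def by simp
  finally show "integral\<^sup>L lborel g = cis (2 * pi * x * of_int (\<Sum>j\<in>UNIV. k j)) * wave_integral m k \<sigma> (\<sigma> * x)" .
qed

definition rs_box :: "nat \<Rightarrow> ('n \<Rightarrow> int) set" where
  "rs_box K = (UNIV \<rightarrow>\<^sub>E rs_range K)"

lemma finite_rs_box: "finite (rs_box K :: ('n::finite \<Rightarrow> int) set)"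
  by (simp add: rs_box_def finite_PiE finite_rs_range)

text \<open>The Fourier transform of each input is a finite sum of signed normal densities;
  multiplying out the \<open>n\<close> sums gives one term for each lattice point of the
  box.\<close>

lemma multiplier_op_rs_packet:
  fixes m :: "real ^ 'n::finite \<Rightarrow> real"
  assumes m: "m \<in> borel_measurable borel" "\<And>\<xi>. \<bar>m \<xi>\<bar> \<le> B" and \<sigma>: "0 < \<sigma>"
  shows "multiplier_op m (\<lambda>_. rs_packet K \<sigma>) x =
    (\<Sum>k\<in>rs_box K. of_real (\<Prod>j\<in>UNIV. rs_coeff (k j)) *
       (cis (2 * pi * x * of_int (\<Sum>j\<in>UNIV. k j)) * wave_integral m k \<sigma> (\<sigma> * x)))"
proof -
  let ?g = "\<lambda>k (\<xi>::real^'n). of_real (m \<xi>) *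
    (\<Prod>j\<in>UNIV. of_real (normal_density (of_int (k j)) \<sigma> (\<xi> $ j)) * cis (2 * pi * x * \<xi> $ j))"
  let ?F = "\<lambda>\<xi>::real^'n. of_real (m \<xi>) *
        (\<Prod>j\<in>UNIV. fourier (rs_packet K \<sigma>) (\<xi> $ j) * cis (2 * pi * x * \<xi> $ j))"
  have expand: "?F \<xi> = (\<Sum>k\<in>rs_box K. of_real (\<Prod>j\<in>UNIV. rs_coeff (k j)) * ?g k \<xi>)" for \<xi> :: "real ^ 'n"
  proof -
    have "(\<Prod>j\<in>UNIV. fourier (rs_packet K \<sigma>) (\<xi> $ j) * cis (2 * pi * x * \<xi> $ j)) =
      (\<Prod>j\<in>UNIV. \<Sum>l\<in>rs_range K. of_real (rs_coeff l * normal_density (of_int l) \<sigma> (\<xi> $ j)) * cis (2 * pi * x * \<xi> $ j))"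
      by (simp add: fourier_rs_packet[OF \<sigma>] sum_distrib_right)
    also have "\<dots> = (\<Sum>k\<in>rs_box K. \<Prod>j\<in>UNIV. of_real (rs_coeff (k j) * normal_density (of_int (k j)) \<sigma> (\<xi> $ j)) * cis (2 * pi * x * \<xi> $ j))"
      unfolding rs_box_def by (rule prod_sum_PiE) (auto simp: finite_rs_range)
    also have "\<dots> = (\<Sum>k\<in>rs_box K. of_real (\<Prod>j\<in>UNIV. rs_coeff (k j)) *
        (\<Prod>j\<in>UNIV. of_real (normal_density (of_int (k j)) \<sigma> (\<xi> $ j)) * cis (2 * pi * x * \<xi> $ j)))"
      by (simp add: prod.distrib mult.assoc)
    finally show ?thesis
      by (simp add: sum_distrib_left mult_ac)
  qed
  have int: "integrable lborel (?g k)" for k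
    by (rule normal_product_integral[OF m \<sigma>])
  have "?F \<in> borel_measurable lborel"
    unfolding expand
    by (intro borel_measurable_sum borel_measurable_times[OF borel_measurable_const] borel_measurable_integrable int)
  then have "multiplier_op m (\<lambda>_. rs_packet K \<sigma>) x = integral\<^sup>L lborel ?F"
    unfolding multiplier_op_def by (rule integral_completion)
  also have "\<dots> = (\<Sum>k\<in>rs_box K. LINT \<xi>|lborel. of_real (\<Prod>j\<in>UNIV. rs_coeff (k j)) * ?g k \<xi>)"
    unfolding expand by (rule Bochner_Integration.integral_sum) (intro integrable_mult_right int)
  also have "\<dots> = (\<Sum>k\<in>rs_box K. of_real (\<Prod>j\<in>UNIV. rs_coeff (k j)) * integral\<^sup>L lborel (?g k))"
    by simp
  finally show ?thesis
    unfolding normal_product_integral(2)[OF m \<sigma>] .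
qed

text \<open>The profile that all lattice points share in the limit: \<open>wave_integral\<close> for
  the constant symbol 1, which depends neither on \<open>k\<close> nor on \<sigma>.\<close>

definition gauss_wave :: "'n::finite itself \<Rightarrow> real \<Rightarrow> complex" where
  "gauss_wave _ y = (LINT \<eta>|lborel. cis (2 * pi * y * (\<Sum>j\<in>UNIV. \<eta> $ (j :: 'n))) * of_real (std_gauss \<eta>))"

text \<open>The value at 0 is the total mass 1, and dominated convergence along a sequence tending
  to 0 gives continuity there, so no explicit formula for the profile is called for.\<close>

lemma gauss_wave_lower_bound:
  "\<exists>\<delta>>0. \<forall>y. \<bar>y\<bar> \<le> \<delta> \<longrightarrow> 1 / 2 \<le> norm (gauss_wave TYPE('n::finite) y)"
proof (rule ccontr)
  assume *: "\<not> ?thesis"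
  have "\<exists>y. \<bar>y\<bar> \<le> 1 / real (Suc i) \<and> norm (gauss_wave TYPE('n) y) < 1 / 2" for i
  proof (rule ccontr)
    assume "\<not> ?thesis"
    then have "0 < 1 / real (Suc i) \<and> (\<forall>y. \<bar>y\<bar> \<le> 1 / real (Suc i) \<longrightarrow> 1 / 2 \<le> norm (gauss_wave TYPE('n) y))"
      by (auto simp: not_less)
    with * show False
      by blast
  qed
  then obtain y where y: "\<And>i. \<bar>y i\<bar> \<le> 1 / real (Suc i)" "\<And>i. norm (gauss_wave TYPE('n) (y i)) < 1 / 2"
    by metis
  have y0: "y \<longlonglongrightarrow> 0"
    using y(1) LIMSEQ_Suc[OF lim_1_over_n] by (intro Lim_null_comparison[of y "\<lambda>i. 1 / real (Suc i)"]) auto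
  have "(\<lambda>i. gauss_wave TYPE('n) (y i)) \<longlonglongrightarrow> gauss_wave TYPE('n) 0"
    unfolding gauss_wave_def
  proof (rule integral_dominated_convergence[where w = std_gauss])
    show "AE \<eta>::real^'n in lborel. (\<lambda>i. cis (2 * pi * y i * (\<Sum>j\<in>UNIV. \<eta> $ j)) * complex_of_real (std_gauss \<eta>))
        \<longlonglongrightarrow> cis (2 * pi * 0 * (\<Sum>j\<in>UNIV. \<eta> $ j)) * complex_of_real (std_gauss \<eta>)"
      by (intro AE_I2 tendsto_intros y0)
  qed (auto simp: integrable_std_gauss norm_mult std_gauss_nonneg)
  moreover have "gauss_wave TYPE('n) 0 = 1"
    by (simp add: gauss_wave_def integral_std_gauss)
  ultimately have "(\<lambda>i. norm (gauss_wave TYPE('n) (y i))) \<longlonglongrightarrow> 1"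
    using tendsto_norm by fastforce
  then have "1 \<le> (1/2::real)"
    using y(2) by (intro LIMSEQ_le_const2) (auto intro: less_imp_le)
  then show False
    by simp
qed

text \<open>Uniformity in \<open>y\<close> is essential, as the output is studied on a whole
  interval. Taking absolute values inside the integral removes the phase and leaves a bound free of
  \<open>y\<close>, which tends to 0 by dominated convergence and continuity of
  \<open>m\<close>.\<close>

lemma wave_integral_convergence:
  fixes m :: "real ^ 'n::finite \<Rightarrow> real"
  assumes cont: "continuous_on UNIV m" and m: "\<And>\<xi>. \<bar>m \<xi>\<bar> \<le> B" and A: "finite A" and \<epsilon>: "0 < \<epsilon>"
  shows "\<exists>\<sigma>>0. \<forall>y. (\<Sum>k\<in>A. norm (wave_integral m k \<sigma> y -
    of_real (m (lattice_point k)) * gauss_wave TYPE('n) y)) < \<epsilon>"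
proof -
  have [measurable]: "m \<in> borel_measurable borel"
    by (rule borel_measurable_continuous_onI[OF cont])
  define s where "s i = 1 / real (Suc i)" for i
  have s0: "s \<longlonglongrightarrow> 0"
    unfolding s_def using LIMSEQ_Suc[OF lim_1_over_n] by simp
  define e where "e k i = (LINT \<eta>|lborel. \<bar>m (lattice_point k + s i *\<^sub>R \<eta>) - m (lattice_point k)\<bar> * std_gauss \<eta>)"
    for k i
  have mb: "\<bar>m u - m v\<bar> \<le> 2 * B" for u v
    using m[of u] m[of v] by linarith
  have ei: "integrable lborel (\<lambda>\<eta>. \<bar>m (lattice_point k + s i *\<^sub>R \<eta>) - m (lattice_point k)\<bar> * std_gauss \<eta>)" for k i
  proof (rule Bochner_Integration.integrable_bound)
    show "integrable lborel (\<lambda>\<eta>::real^'n. 2 * B * std_gauss \<eta>)"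
      by (intro integrable_mult_right integrable_std_gauss)
    show "AE \<eta> in lborel. norm (\<bar>m (lattice_point k + s i *\<^sub>R \<eta>) - m (lattice_point k)\<bar> * std_gauss \<eta>)
        \<le> norm (2 * B * std_gauss \<eta>)"
      using order_trans[OF mb abs_ge_self] std_gauss_nonneg
      by (intro AE_I2) (simp add: abs_mult mult_right_mono)
  qed measurable
  have "e k \<longlonglongrightarrow> (LINT \<eta>|(lborel :: (real^'n) measure). 0)" for k
    unfolding e_def
  proof (rule integral_dominated_convergence[where w = "\<lambda>\<eta>. 2 * B * std_gauss \<eta>"])
    show "AE \<eta> in lborel. (\<lambda>i. \<bar>m (lattice_point k + s i *\<^sub>R \<eta>) - m (lattice_point k)\<bar> * std_gauss \<eta>) \<longlonglongrightarrow> 0"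
    proof (rule AE_I2)
      fix \<eta> :: "real ^ 'n"
      have "isCont m (lattice_point k + 0 *\<^sub>R \<eta>)"
        using cont by (simp add: continuous_on_eq_continuous_at)
      then have "(\<lambda>i. m (lattice_point k + s i *\<^sub>R \<eta>)) \<longlonglongrightarrow> m (lattice_point k + 0 *\<^sub>R \<eta>)"
        by (rule isCont_tendsto_compose) (intro tendsto_intros s0)
      then have "(\<lambda>i. \<bar>m (lattice_point k + s i *\<^sub>R \<eta>) - m (lattice_point k)\<bar> * std_gauss \<eta>)
        \<longlonglongrightarrow> \<bar>m (lattice_point k + 0 *\<^sub>R \<eta>) - m (lattice_point k)\<bar> * std_gauss \<eta>"
        by (intro tendsto_intros)
      then show "(\<lambda>i. \<bar>m (lattice_point k + s i *\<^sub>R \<eta>) - m (lattice_point k)\<bar> * std_gauss \<eta>) \<longlonglongrightarrow> 0"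
        by simp
    qed
    show "integrable lborel (\<lambda>\<eta>::real^'n. 2 * B * std_gauss \<eta>)"
      by (intro integrable_mult_right integrable_std_gauss)
    show "AE \<eta> in lborel. norm (\<bar>m (lattice_point k + s i *\<^sub>R \<eta>) - m (lattice_point k)\<bar> * std_gauss \<eta>)
        \<le> 2 * B * std_gauss \<eta>" for i
      using mb by (intro AE_I2) (simp add: abs_mult std_gauss_nonneg mult_right_mono)
  qed measurable
  then have "(\<lambda>i. \<Sum>k\<in>A. e k i) \<longlonglongrightarrow> (\<Sum>k\<in>A. 0)"
    by (intro tendsto_sum) simp
  then have "\<forall>\<^sub>F i in sequentially. (\<Sum>k\<in>A. e k i) < \<epsilon>"
    using \<epsilon> by (intro order_tendstoD) simp_all
  then obtain i where i: "(\<Sum>k\<in>A. e k i) < \<epsilon>"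
    by (auto simp: eventually_sequentially)
  have le: "norm (wave_integral m k (s i) y - of_real (m (lattice_point k)) * gauss_wave TYPE('n) y) \<le> e k i" for k y
  proof -
    let ?c = "\<lambda>\<eta>::real^'n. cis (2 * pi * y * (\<Sum>j\<in>UNIV. \<eta> $ j))"
    let ?m = "\<lambda>\<eta>. complex_of_real (m (lattice_point k + s i *\<^sub>R \<eta>)) * ?c \<eta>"
    have "integrable lborel (\<lambda>\<eta>. ?m \<eta> * of_real (std_gauss \<eta>))"
      by (rule integrable_bounded_mult[OF integrable_std_gauss, where B = B]) (use m in \<open>auto simp: norm_mult\<close>)
    moreover have int1: "integrable lborel (\<lambda>\<eta>. ?c \<eta> * of_real (std_gauss \<eta>))"
      by (rule integrable_bounded_mult[OF integrable_std_gauss, where B = 1]) auto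
    ultimately have eq: "wave_integral m k (s i) y - of_real (m (lattice_point k)) * gauss_wave TYPE('n) y =
       (LINT \<eta>|lborel. ?m \<eta> * of_real (std_gauss \<eta>) -
          of_real (m (lattice_point k)) * (?c \<eta> * of_real (std_gauss \<eta>)))"
      unfolding wave_integral_def gauss_wave_def by (subst Bochner_Integration.integral_diff) auto
    have "norm (wave_integral m k (s i) y - of_real (m (lattice_point k)) * gauss_wave TYPE('n) y) \<le>
        (LINT \<eta>|lborel. norm (?m \<eta> * of_real (std_gauss \<eta>) -
          of_real (m (lattice_point k)) * (?c \<eta> * of_real (std_gauss \<eta>))))"
      unfolding eq by (rule integral_norm_bound)
    also have "\<dots> = e k i"
      unfolding e_def
    proof (rule Bochner_Integration.integral_cong[OF refl])
      fix \<eta> :: "real ^ 'n"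
      have "?m \<eta> * of_real (std_gauss \<eta>) - of_real (m (lattice_point k)) * (?c \<eta> * of_real (std_gauss \<eta>)) =
        of_real (m (lattice_point k + s i *\<^sub>R \<eta>) - m (lattice_point k)) * ?c \<eta> * of_real (std_gauss \<eta>)"
        by (simp only: of_real_diff left_diff_distrib mult.assoc)
      then show "norm (?m \<eta> * of_real (std_gauss \<eta>) - of_real (m (lattice_point k)) * (?c \<eta> * of_real (std_gauss \<eta>))) =
        \<bar>m (lattice_point k + s i *\<^sub>R \<eta>) - m (lattice_point k)\<bar> * std_gauss \<eta>"
        by (simp only: norm_mult norm_cis norm_of_real std_gauss_nonneg abs_of_nonneg mult_1_right)
    qed
    finally show ?thesis .
  qed
  have "(\<Sum>k\<in>A. norm (wave_integral m k (s i) y - of_real (m (lattice_point k)) * gauss_wave TYPE('n) y)) < \<epsilon>" for y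
    by (rule le_less_trans[OF sum_mono i]) (rule le)
  moreover have "0 < s i"
    by (simp add: s_def)
  ultimately show ?thesis
    by blast
qed

section \<open>The signed symbol and its lower bound\<close>

definition rs_symbol :: "('n \<Rightarrow> int) set \<Rightarrow> real ^ 'n::finite \<Rightarrow> real" where
  "rs_symbol \<Lambda> = lattice_symbol (\<lambda>_. 0) (\<lambda>k. if k \<in> \<Lambda> then \<Prod>j\<in>UNIV. rs_coeff (k j) else 0)"

lemma abs_rs_symbol_coeff: "\<bar>if k \<in> \<Lambda> then \<Prod>j\<in>UNIV. rs_coeff (k j) else 0\<bar> \<le> 1"
  by (simp add: abs_prod abs_rs_coeff)

text \<open>At a point of \<Lambda> the sign of the symbol cancels the product of the input signs
  and the phase is 1, so every such point contributes the same profile, of modulus at least 1/2; the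
  total error is kept below 1/4. The order of choice matters: \<delta> precedes \<open>K\<close>
  while \<sigma> may depend on it, because the constants obtained later depend on \<delta> but must
  not depend on \<open>K\<close>.\<close>

lemma rs_symbol_lower_bound:
  "\<exists>\<delta>>0. \<forall>\<Lambda> K. (\<forall>k\<in>\<Lambda>. (\<Sum>j\<in>UNIV. k j) = 0) \<longrightarrow>
     (\<exists>\<sigma>>0. \<forall>x. \<bar>x\<bar> \<le> \<delta> / \<sigma> \<longrightarrow>
        real (card (\<Lambda> \<inter> rs_box K)) / 2 - 1 / 4 \<le>
          norm (multiplier_op (rs_symbol (\<Lambda> :: ('n::finite \<Rightarrow> int) set)) (\<lambda>_. rs_packet K \<sigma>) x))"
proof -
  obtain \<delta> where \<delta>: "\<delta> > 0" "\<And>y. \<bar>y\<bar> \<le> \<delta> \<Longrightarrow> 1 / 2 \<le> norm (gauss_wave TYPE('n) y)"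
    using gauss_wave_lower_bound[where 'n = 'n] by blast
  have "\<exists>\<sigma>>0. \<forall>x. \<bar>x\<bar> \<le> \<delta> / \<sigma> \<longrightarrow> real (card (\<Lambda> \<inter> rs_box K)) / 2 - 1 / 4 \<le>
          norm (multiplier_op (rs_symbol \<Lambda>) (\<lambda>_. rs_packet K \<sigma>) x)"
    if \<Lambda>: "\<forall>k\<in>\<Lambda>. (\<Sum>j\<in>UNIV. k j) = 0" for \<Lambda> :: "('n \<Rightarrow> int) set" and K
  proof -
    let ?m = "rs_symbol \<Lambda>"
    let ?a = "\<lambda>k :: 'n \<Rightarrow> int. \<Prod>j\<in>UNIV. rs_coeff (k j)"
    have cont: "continuous_on UNIV ?m"
      unfolding rs_symbol_def
      by (intro differentiable_imp_continuous_on differentiable_at_imp_differentiable_on lattice_symbol_differentiable)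
    obtain B where B: "\<And>\<xi>. \<bar>?m \<xi>\<bar> \<le> B"
      unfolding rs_symbol_def using lattice_symbol_bounded[of "\<lambda>k. if k \<in> \<Lambda> then ?a k else 0" "\<lambda>_. 0",
          OF abs_rs_symbol_coeff] by blast
    have m: "?m (lattice_point k) = (if k \<in> \<Lambda> then ?a k else 0)" for k
      by (simp add: rs_symbol_def lattice_point_def lattice_symbol_at_lattice)
    have "\<exists>\<sigma>>0. \<forall>y. (\<Sum>k\<in>rs_box K. norm (wave_integral ?m k \<sigma> y -
        of_real (?m (lattice_point k)) * gauss_wave TYPE('n) y)) < 1 / 4"
      by (rule wave_integral_convergence[OF cont B finite_rs_box]) simp
    then obtain \<sigma> where \<sigma>: "0 < \<sigma>" "\<And>y. (\<Sum>k\<in>rs_box K. norm (wave_integral ?m k \<sigma> y -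
        of_real (?m (lattice_point k)) * gauss_wave TYPE('n) y)) < 1 / 4"
      by blast
    have "real (card (\<Lambda> \<inter> rs_box K)) / 2 - 1 / 4 \<le> norm (multiplier_op ?m (\<lambda>_. rs_packet K \<sigma>) x)"
      if x: "\<bar>x\<bar> \<le> \<delta> / \<sigma>" for x
    proof -
      let ?T = "multiplier_op ?m (\<lambda>_. rs_packet K \<sigma>) x"
      let ?c = "\<lambda>k :: 'n \<Rightarrow> int. cis (2 * pi * x * of_int (\<Sum>j\<in>UNIV. k j))"
      let ?W = "gauss_wave TYPE('n) (\<sigma> * x)"
      have sq: "?a k * ?a k = 1" for k
      proof -
        have "\<bar>?a k\<bar> = 1"
          by (simp add: abs_prod abs_rs_coeff)
        then show ?thesis
          by (metis abs_mult_self_eq mult_1)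
      qed
      have "(\<Sum>k\<in>rs_box K. of_real (?a k) * (?c k * (of_real (?m (lattice_point k)) * ?W))) =
          (\<Sum>k\<in>rs_box K. if k \<in> \<Lambda> then ?W else 0)"
      proof (rule sum.cong[OF refl])
        fix k :: "'n \<Rightarrow> int"
        show "of_real (?a k) * (?c k * (of_real (?m (lattice_point k)) * ?W)) = (if k \<in> \<Lambda> then ?W else 0)"
        proof (cases "k \<in> \<Lambda>")
          case True
          then have "?c k = 1"
            using \<Lambda> by simp
          then have "of_real (?a k) * (?c k * (of_real (?m (lattice_point k)) * ?W)) = of_real (?a k * ?a k) * ?W"
            using True by (simp only: m if_True of_real_mult mult_1 mult.assoc)
          then show ?thesis
            using True by (simp only: sq of_real_1 mult_1 if_True)
        qed (simp add: m)
      qed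
      also have "\<dots> = of_nat (card (\<Lambda> \<inter> rs_box K)) * ?W"
        using finite_rs_box[where 'n = 'n and K = K] by (simp add: sum.If_cases Int_commute)
      finally have main: "(\<Sum>k\<in>rs_box K. of_real (?a k) * (?c k * (of_real (?m (lattice_point k)) * ?W))) =
        of_nat (card (\<Lambda> \<inter> rs_box K)) * ?W" .
      have eq: "?T - of_nat (card (\<Lambda> \<inter> rs_box K)) * ?W = (\<Sum>k\<in>rs_box K. of_real (?a k) *
          (?c k * (wave_integral ?m k \<sigma> (\<sigma> * x) - of_real (?m (lattice_point k)) * ?W)))"
        unfolding main[symmetric] multiplier_op_rs_packet[OF borel_measurable_continuous_onI[OF cont] B \<sigma>(1)]
          sum_subtractf[symmetric] by (simp only: right_diff_distrib)
      have "norm (?T - of_nat (card (\<Lambda> \<inter> rs_box K)) * ?W) \<le>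
          (\<Sum>k\<in>rs_box K. norm (wave_integral ?m k \<sigma> (\<sigma> * x) - of_real (?m (lattice_point k)) * ?W))"
        unfolding eq by (intro sum_norm_le) (simp add: norm_mult prod_norm[symmetric] abs_rs_coeff)
      also have "\<dots> < 1 / 4"
        by (rule \<sigma>(2))
      finally have "norm (of_nat (card (\<Lambda> \<inter> rs_box K)) * ?W) - norm ?T < 1 / 4"
        using norm_triangle_ineq2[of "of_nat (card (\<Lambda> \<inter> rs_box K)) * ?W" ?T] by (simp add: norm_minus_commute)
      moreover have "\<bar>\<sigma> * x\<bar> \<le> \<delta>"
        using x \<sigma>(1) by (simp add: abs_mult field_simps)
      then have "real (card (\<Lambda> \<inter> rs_box K)) * (1 / 2) \<le> norm (of_nat (card (\<Lambda> \<inter> rs_box K)) * ?W)"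
        unfolding norm_mult norm_of_nat by (intro mult_left_mono \<delta>(2)) auto
      ultimately show ?thesis
        by linarith
    qed
    with \<sigma>(1) show ?thesis
      by blast
  qed
  with \<delta>(1) show ?thesis
    by blast
qed


subsection \<open>Norm bounds\<close>

lemma nn_integral_gauss:
  assumes "0 < s"
  shows "(\<integral>\<^sup>+x. ennreal (exp (- (s * x)\<^sup>2 / 2)) \<partial>lborel) = ennreal (sqrt (2 * pi) / s)"
proof -
  have "integrable lborel (\<lambda>x. complex_of_real (exp (- (s * x)\<^sup>2 / 2)))"
    using integral_gauss_cis(2)[OF assms, of 0] by simp
  then have int: "integrable lborel (\<lambda>x. exp (- (s * x)\<^sup>2 / 2))"
    by (rule complex_of_real_integrable_eq[THEN iffD1])
  have "complex_of_real (LINT x|lborel. exp (- (s * x)\<^sup>2 / 2)) = complex_of_real (sqrt (2 * pi) / s)"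
    using integral_gauss_cis(1)[OF assms, of 0] by simp
  then have "(LINT x|lborel. exp (- (s * x)\<^sup>2 / 2)) = sqrt (2 * pi) / s"
    by (simp only: of_real_eq_iff)
  then show ?thesis
    using nn_integral_eq_integral[OF int] by simp
qed

lemma enn2real_mono_finite: "x \<le> y \<Longrightarrow> y \<noteq> \<infinity> \<Longrightarrow> enn2real x \<le> enn2real y"
  by (simp add: enn2real_mono top.not_eq_extremum)

text \<open>The Gaussian \<open>?e\<close> is at most 1, so its powers with exponent at least 1 lie
  below it and its integral serves for every finite \<open>p\<close>. For infinite \<open>p\<close>
  the exponent \<open>inverse p\<close> is 0 and the same formula gives the uniform bound.\<close>

lemma Lp_norm_rs_packet_le:
  assumes \<sigma>: "0 < \<sigma>" and p: "1 \<le> p"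
  shows "Lp_norm p (rs_packet K \<sigma>) \<le>
    ennreal (4 * sqrt (2 ^ K) * (sqrt (2 * pi) / (2 * pi * \<sigma>)) powr enn2real (inverse p))"
proof -
  define A where "A = 4 * sqrt (2 ^ K)"
  define L where "L = sqrt (2 * pi) / (2 * pi * \<sigma>)"
  have A: "0 < A" and L: "0 < L"
    using \<sigma> by (auto simp: A_def L_def)
  let ?e = "\<lambda>x. exp (- (2 * pi * \<sigma> * x)\<^sup>2 / 2)"
  have le: "norm (rs_packet K \<sigma> x) \<le> A * ?e x" for x
    unfolding A_def by (rule norm_rs_packet)
  have e1: "?e x \<le> 1" for x
    by simp
  have meas [measurable]: "rs_packet K \<sigma> \<in> borel_measurable borel"
    by (rule borel_measurable_continuous_onI[OF continuous_rs_packet])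
  show ?thesis
  proof (cases "p = \<infinity>")
    case True
    have "ennreal (norm (rs_packet K \<sigma> x)) \<le> ennreal A" for x
      using order_trans[OF le mult_left_mono[OF e1]] A by (intro ennreal_leI) simp
    moreover have "(\<lambda>x. ennreal (norm (rs_packet K \<sigma> x))) \<in> borel_measurable lebesgue"
      by (intro measurable_completion) measurable
    ultimately have "esssup lebesgue (\<lambda>x. ennreal (norm (rs_packet K \<sigma> x))) \<le> ennreal A"
      by (intro esssup_I) auto
    then show ?thesis
      using True \<sigma> by (simp add: Lp_norm_def A_def)
  next
    case False
    define q where "q = enn2real p"
    have pq: "p = ennreal q"
      using False by (simp add: q_def top.not_eq_extremum)
    have q: "1 \<le> q"
      using p by (simp add: pq)
    define I where "I = (\<integral>\<^sup>+x. ennreal (norm (rs_packet K \<sigma> x) powr q) \<partial>lebesgue)"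
    have "I = (\<integral>\<^sup>+x. ennreal (norm (rs_packet K \<sigma> x) powr q) \<partial>lborel)"
      unfolding I_def by (rule nn_integral_completion)
    also have "\<dots> \<le> (\<integral>\<^sup>+x. ennreal (A powr q) * ennreal (?e x) \<partial>lborel)"
    proof (intro nn_integral_mono)
      fix x :: real
      have "norm (rs_packet K \<sigma> x) powr q \<le> (A * ?e x) powr q"
        using q le by (intro powr_mono2) auto
      also have "\<dots> = A powr q * ?e x powr q"
        by (rule powr_mult)
      also have "?e x powr q \<le> ?e x powr 1"
        using q by (intro powr_mono') auto
      then have "A powr q * ?e x powr q \<le> A powr q * ?e x"
        by (intro mult_left_mono) auto
      finally show "ennreal (norm (rs_packet K \<sigma> x) powr q) \<le> ennreal (A powr q) * ennreal (?e x)"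
        by (simp add: ennreal_mult'[symmetric] ennreal_leI)
    qed
    also have "\<dots> = ennreal (A powr q) * (\<integral>\<^sup>+x. ennreal (?e x) \<partial>lborel)"
      by (rule nn_integral_cmult) measurable
    also have "\<dots> = ennreal (A powr q * L)"
    proof -
      have "(\<integral>\<^sup>+x. ennreal (?e x) \<partial>lborel) = ennreal L"
        unfolding L_def using \<sigma> by (intro nn_integral_gauss) simp
      then show ?thesis
        using L by (simp only: ennreal_mult' powr_ge_zero)
    qed
    finally have I: "I \<le> ennreal (A powr q * L)" .
    have "enn2real I \<le> A powr q * L"
      using enn2real_mono_finite[OF I] L by simp
    then have "enn2real I powr (1 / q) \<le> (A powr q * L) powr (1 / q)"
      using q by (intro powr_mono2) auto
    also have "\<dots> = A * L powr (1 / q)"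
      using A L q by (simp add: powr_mult powr_powr)
    finally have "enn2real I powr (1 / q) \<le> A * L powr (1 / q)" .
    moreover have "enn2real (inverse p) = 1 / q"
      using q by (simp add: pq inverse_ennreal inverse_eq_divide)
    moreover have "I \<noteq> \<infinity>"
      using I by (auto simp: top_unique)
    ultimately show ?thesis
      unfolding Lp_norm_def Let_def q_def[symmetric] I_def[symmetric]
      using False by (simp add: A_def[symmetric] L_def[symmetric] ennreal_leI)
  qed
qed

text \<open>Stated through the reciprocal \<open>s\<close> of the exponent, since that is the sum
  which the estimate supplies: \<open>s = 0\<close> is the essential supremum, and
  \<open>s > 1\<close> a quasi-norm. Restriction to the interval of length \<open>2 * r\<close> is
  enough in every case.\<close>

lemma Lp_norm_ge:
  assumes a: "0 < a" and r: "0 < r" and g: "\<And>x. \<bar>x\<bar> \<le> r \<Longrightarrow> a \<le> norm (g x)" and s: "s \<noteq> \<infinity>"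
  shows "ennreal (a * (2 * r) powr enn2real s) \<le> Lp_norm (inverse s) g"
proof (cases "s = 0")
  case True
  have "ennreal a \<le> esssup lebesgue (\<lambda>x. ennreal (norm (g x)))"
  proof (rule ccontr)
    assume *: "\<not> ?thesis"
    have "AE x in lebesgue. ennreal (norm (g x)) \<le> esssup lebesgue (\<lambda>x. ennreal (norm (g x)))"
      by (rule esssup_AE)
    then have "AE x in lebesgue. x \<notin> {-r..r}"
    proof (rule AE_mp, intro AE_I2 impI notI)
      fix x assume le: "ennreal (norm (g x)) \<le> esssup lebesgue (\<lambda>x. ennreal (norm (g x)))" and x: "x \<in> {-r..r}"
      have "ennreal a \<le> ennreal (norm (g x))"
        using g[of x] x by (intro ennreal_leI) (auto simp: abs_le_iff)
      with le * show False
        using order_trans by blast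
    qed
    then have "emeasure lebesgue {-r..r} = 0"
      by (subst (asm) AE_iff_measurable[of "{-r..r}"]) auto
    then show False
      using r by simp
  qed
  then show ?thesis
    using True r by (simp add: Lp_norm_def)
next
  case False
  define t where "t = enn2real s"
  have st: "s = ennreal t"
    using s by (simp add: t_def top.not_eq_extremum)
  have t: "0 < t"
    using False st by (cases "t > 0") (auto simp: ennreal_neg)
  have inv: "inverse s = ennreal (1 / t)"
    using t by (simp add: st inverse_ennreal inverse_eq_divide)
  define I where "I = (\<integral>\<^sup>+x. ennreal (norm (g x) powr (1 / t)) \<partial>lebesgue)"
  have "ennreal (a powr (1 / t) * (2 * r)) = (\<integral>\<^sup>+x. ennreal (a powr (1 / t)) * indicator {-r..r} x \<partial>lebesgue)"
    using r by (subst nn_integral_cmult_indicator) (auto simp: ennreal_mult')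
  also have "\<dots> \<le> I"
    unfolding I_def
  proof (intro nn_integral_mono)
    fix x :: real
    show "ennreal (a powr (1 / t)) * indicator {-r..r} x \<le> ennreal (norm (g x) powr (1 / t))"
      using g[of x] a t by (auto simp: indicator_def abs_le_iff intro!: ennreal_leI powr_mono2)
  qed
  finally have I: "ennreal (a powr (1 / t) * (2 * r)) \<le> I" .
  show ?thesis
  proof (cases "I = \<infinity>")
    case True
    then show ?thesis
      unfolding Lp_norm_def Let_def inv using t by (simp add: I_def[symmetric])
  next
    case fin: False
    have "a powr (1 / t) * (2 * r) \<le> enn2real I"
      using enn2real_mono_finite[OF I fin] r by simp
    then have "(a powr (1 / t) * (2 * r)) powr t \<le> enn2real I powr t"
      using t r by (intro powr_mono2) auto
    moreover have "(a powr (1 / t) * (2 * r)) powr t = a * (2 * r) powr t"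
      using a r t by (simp add: powr_mult powr_powr)
    ultimately have "ennreal (a * (2 * r) powr t) \<le> ennreal (enn2real I powr t)"
      by (simp add: ennreal_leI)
    then show ?thesis
      unfolding Lp_norm_def Let_def inv using t fin
      by (simp add: I_def[symmetric] t_def[symmetric])
  qed
qed

lemma prod_mono_ennreal:
  fixes f g :: "'a \<Rightarrow> ennreal"
  assumes "\<And>i. i \<in> A \<Longrightarrow> f i \<le> g i"
  shows "prod f A \<le> prod g A"
  using assms by (induction A rule: infinite_finite_induct) (auto intro!: mult_mono)

text \<open>The output norm is at least \<open>a\<close> times a multiple of
  \<open>\<sigma> powr (- S)\<close>, and the input norms contribute the powers of
  \<open>1 / \<sigma>\<close> with exponents \<open>inverse (p j)\<close>, whose sum is
  \<open>S\<close>. So \<sigma> cancels; \<open>D\<close> is what remains of the scaling factors,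
  and \<open>4 ^ CARD('n)\<close> comes from the constant of the trigonometric sum.\<close>

lemma estimate_rs_packet:
  fixes p :: "'n::finite \<Rightarrow> ennreal"
  assumes p: "\<And>j. 1 \<le> p j" and est: "satisfies_Lp_estimate T p" and \<delta>: "0 < \<delta>"
  shows "\<exists>C. \<forall>K \<sigma> a. 0 < \<sigma> \<longrightarrow> 0 < a \<longrightarrow> (\<forall>x. \<bar>x\<bar> \<le> \<delta> / \<sigma> \<longrightarrow> a \<le> norm (T (\<lambda>_. rs_packet K \<sigma>) x)) \<longrightarrow>
    a \<le> C * sqrt (2 ^ K) ^ CARD('n)"
proof -
  obtain C where C: "\<And>f. \<forall>j. f j \<in> schwartz \<Longrightarrow>
        Lp_norm (inverse (\<Sum>j\<in>UNIV. inverse (p j))) (T f) \<le> ennreal C * (\<Prod>j\<in>UNIV. Lp_norm (p j) (f j))"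
    using est unfolding satisfies_Lp_estimate_def by blast
  define S where "S = (\<Sum>j\<in>UNIV. inverse (p j))"
  have inv_le: "inverse (p j) \<le> 1" for j
    using p[of j] by (cases "p j" rule: ennreal_cases) (auto simp: inverse_ennreal inverse_le_1_iff)
  then have inv_fin: "inverse (p j) < top" for j
    using le_less_trans ennreal_one_less_top by blast
  have "p j \<noteq> 0" for j
    using p[of j] by auto
  then have S: "S \<noteq> \<infinity>"
    by (simp add: S_def)
  have Ssum: "enn2real S = (\<Sum>j\<in>UNIV. enn2real (inverse (p j)))"
    unfolding S_def using inv_fin by (subst enn2real_sum) (auto simp: o_def)
  define D where "D = (sqrt (2 * pi) / (4 * pi * \<delta>)) powr enn2real S"
  have "a \<le> (max 0 C * 4 ^ CARD('n) * D) * sqrt (2 ^ K) ^ CARD('n)"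
    if \<sigma>: "0 < \<sigma>" and a: "0 < a" and T: "\<And>x. \<bar>x\<bar> \<le> \<delta> / \<sigma> \<Longrightarrow> a \<le> norm (T (\<lambda>_. rs_packet K \<sigma>) x)"
    for K \<sigma> a
  proof -
    define L where "L = sqrt (2 * pi) / (2 * pi * \<sigma>)"
    have L: "0 < L"
      using \<sigma> by (simp add: L_def)
    let ?A = "4 * sqrt (2 ^ K) :: real"
    have "ennreal (a * (2 * (\<delta> / \<sigma>)) powr enn2real S) \<le> Lp_norm (inverse S) (T (\<lambda>_. rs_packet K \<sigma>))"
      by (rule Lp_norm_ge) (use a T S \<delta> \<sigma> in auto)
    also have "\<dots> \<le> ennreal C * (\<Prod>j\<in>UNIV. Lp_norm (p j) (rs_packet K \<sigma>))"
      unfolding S_def using C[of "\<lambda>_. rs_packet K \<sigma>"] rs_packet_schwartz[of \<sigma> K] \<sigma> by simp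
    also have "\<dots> \<le> ennreal C * (\<Prod>j\<in>UNIV. ennreal (?A * L powr enn2real (inverse (p j))))"
      unfolding L_def by (intro mult_left_mono prod_mono_ennreal Lp_norm_rs_packet_le \<sigma> p) auto
    also have "\<dots> = ennreal C * ennreal (\<Prod>j\<in>UNIV. ?A * L powr enn2real (inverse (p j)))"
      by (subst prod_ennreal) auto
    also have "(\<Prod>j\<in>UNIV. ?A * L powr enn2real (inverse (p j))) = ?A ^ CARD('n) * L powr enn2real S"
      unfolding prod.distrib Ssum using L by (simp add: powr_sum)
    \<comment> \<open>A negative \<open>C\<close> becomes 0 under \<open>ennreal\<close>, hence
      \<open>max 0 C\<close>.\<close>
    also have "ennreal C * ennreal (?A ^ CARD('n) * L powr enn2real S) =
        ennreal (max 0 C * (?A ^ CARD('n) * L powr enn2real S))"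
      by (simp add: ennreal_mult'[symmetric] max_def ennreal_neg)
    finally have "a * (2 * (\<delta> / \<sigma>)) powr enn2real S \<le> max 0 C * (?A ^ CARD('n) * L powr enn2real S)"
      by (subst (asm) ennreal_le_iff) auto
    then have "a \<le> max 0 C * (?A ^ CARD('n) * L powr enn2real S) / (2 * (\<delta> / \<sigma>)) powr enn2real S"
      using \<delta> \<sigma> by (subst pos_le_divide_eq) auto
    also have "\<dots> = max 0 C * ?A ^ CARD('n) * (L / (2 * (\<delta> / \<sigma>))) powr enn2real S"
      using L \<delta> \<sigma> by (subst powr_divide) auto
    also have "L / (2 * (\<delta> / \<sigma>)) = sqrt (2 * pi) / (4 * pi * \<delta>)"
      using \<sigma> \<delta> by (simp add: L_def)
    finally show ?thesis
      by (simp add: D_def power_mult_distrib mult_ac)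
  qed
  then show ?thesis
    by blast
qed


subsection \<open>Lattice points near a non-degenerate subspace\<close>

definition near_lattice :: "real \<Rightarrow> (real ^ 'n::finite) set \<Rightarrow> ('n \<Rightarrow> int) set" where
  "near_lattice R \<Gamma> = {k. (\<Sum>j\<in>UNIV. k j) = 0 \<and> infdist (lattice_point k) \<Gamma> \<le> R}"

lemma mem_rs_box: "k \<in> rs_box K \<longleftrightarrow> (\<forall>j. \<bar>k j\<bar> < 2 ^ K)"
  by (auto simp: rs_box_def rs_range_def PiE_iff abs_less_iff) (metis minus_less_iff)+

text \<open>For a point of the lift, zero sum of the old coordinates means that the coordinate
  \<open>None\<close> is 0. Prescribing \<open>None\<close> together with the \<open>d - 1\<close>
  coordinates in \<open>J\<close> fixes exactly \<open>d\<close> variables, to which the graph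
  property applies.\<close>

lemma nondegenerate_zero_sum_basis:
  fixes \<Gamma> :: "(real ^ 'n::finite) set"
  assumes "nondegenerate_subspace d \<Gamma>" "card J = d - 1" "0 < d" "j \<in> J"
  shows "\<exists>w\<in>\<Gamma>. (\<forall>i\<in>J. w $ i = (if i = j then 1 else 0)) \<and> (\<Sum>i\<in>UNIV. w $ i) = 0"
proof -
  let ?I = "insert None (Some ` J)"
  have "card ?I = d"
    using assms(2,3) by (simp add: card_image image_iff)
  then have "graph_over ?I (lifted_subspace \<Gamma>)"
    using assms(1) by (simp add: nondegenerate_subspace_def)
  then obtain \<xi> where \<xi>: "\<xi> \<in> lifted_subspace \<Gamma>" "\<forall>i\<in>?I. \<xi> $ i = (if i = Some j then 1 else 0)"
    unfolding graph_over_def by (elim allE[of _ "\<lambda>i. if i = Some j then 1 else 0"]) blast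
  have "(\<Sum>i\<in>UNIV. \<xi> $ i) = \<xi> $ None + (\<Sum>i\<in>UNIV. \<xi> $ Some i)"
    by (simp add: UNIV_option_conv sum.reindex)
  then have "(\<Sum>i\<in>UNIV. \<xi> $ Some i) = 0"
    using \<xi> by (simp add: lifted_subspace_def)
  then show ?thesis
    using \<xi> by (intro bexI[of _ "\<chi> i. \<xi> $ Some i"]) (auto simp: lifted_subspace_def)
qed

text \<open>Integer combinations of the vectors \<open>w j\<close> lie in \<Gamma>, have zero sum
  and are integral on \<open>J\<close>. Rounding the remaining coordinates moves them by a bounded
  amount and leaves the coefficients readable on \<open>J\<close>, so distinct coefficients give
  distinct lattice points.\<close>

lemma card_near_lattice:
  fixes \<Gamma> :: "(real ^ 'n::finite) set"
  assumes nd: "nondegenerate_subspace d \<Gamma>" and d: "0 < d" "d \<le> CARD('n)"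
  shows "\<exists>R v. \<forall>u. 2 ^ (u * (d - 1)) \<le> card (near_lattice R \<Gamma> \<inter> rs_box (u + v + 1))"
proof -
  have "d - 1 \<le> card (UNIV :: 'n set)"
    using d by simp
  then obtain J :: "'n set" where J: "card J = d - 1"
    by (rule obtain_subset_with_card_n)
  have "card J < CARD('n)"
    using J d by linarith
  then have "J \<noteq> UNIV"
    by auto
  then obtain i0 where i0: "i0 \<notin> J"
    by blast
  have "\<forall>j\<in>J. \<exists>w. w \<in> \<Gamma> \<and> (\<forall>i\<in>J. w $ i = (if i = j then 1 else 0)) \<and> (\<Sum>i\<in>UNIV. w $ i) = 0"
    using nondegenerate_zero_sum_basis[OF nd J d(1)] by blast
  then obtain w where w: "\<And>j. j \<in> J \<Longrightarrow> w j \<in> \<Gamma>"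
    "\<And>j i. j \<in> J \<Longrightarrow> i \<in> J \<Longrightarrow> w j $ i = (if i = j then 1 else 0)"
    "\<And>j. j \<in> J \<Longrightarrow> (\<Sum>i\<in>UNIV. w j $ i) = 0"
    by metis
  define E where "E = (\<Sum>j\<in>J. \<Sum>i\<in>UNIV. \<bar>w j $ i\<bar>)"
  have "1 < (2::real)"
    by simp
  \<comment> \<open>\<open>2 ^ v\<close> dominates both the growth factor \<open>E\<close> of the
    combinations and the rounding error, so coefficients below \<open>2 ^ u\<close> lead to
    coordinates below \<open>2 ^ u * 2 ^ v + 2 ^ v\<close>, inside the box of exponent
    \<open>u + v + 1\<close>.\<close>
  from real_arch_pow[OF this] obtain v where v: "max E (real CARD('n)) < 2 ^ v"
    by blast
  define x where "x a = (\<Sum>j\<in>J. of_int (a j) *\<^sub>R w j)" for a :: "'n \<Rightarrow> int"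
  \<comment> \<open>The coordinate \<open>i0\<close> absorbs the rounding errors of all others, so
    that the sum is exactly 0. It lies outside \<open>J\<close>, where the coordinates must stay
    untouched; as \<open>x a\<close> has zero sum, the correction is bounded independently of
    \<open>a\<close>.\<close>
  define k where "k a i = (if i = i0 then - (\<Sum>i\<in>UNIV - {i0}. round (x a $ i)) else round (x a $ i))"
    for a i
  have x_nth: "x a $ i = (\<Sum>j\<in>J. of_int (a j) * w j $ i)" for a i
    by (simp add: x_def)
  have x\<Gamma>: "x a \<in> \<Gamma>" for a
    unfolding x_def using nd w(1)
    by (intro subspace_sum subspace_scale) (auto simp: nondegenerate_subspace_def)
  have xJ: "x a $ i = of_int (a i)" if "i \<in> J" for a i
  proof -
    have "x a $ i = (\<Sum>j\<in>J. if j = i then of_int (a i) else 0)"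
      unfolding x_nth using that by (intro sum.cong) (auto simp: w(2))
    then show ?thesis
      using that by simp
  qed
  have x_sum: "(\<Sum>i\<in>UNIV. x a $ i) = 0" for a
  proof -
    have "(\<Sum>i\<in>UNIV. x a $ i) = (\<Sum>j\<in>J. of_int (a j) * (\<Sum>i\<in>UNIV. w j $ i))"
      unfolding x_nth sum_distrib_left by (rule sum.swap)
    then show ?thesis
      by (simp add: w(3))
  qed
  have kx: "\<bar>of_int (k a i) - x a $ i\<bar> \<le> real CARD('n)" for a i
  proof (cases "i = i0")
    case True
    have "x a $ i0 = - (\<Sum>i\<in>UNIV - {i0}. x a $ i)"
      using x_sum[of a] by (simp add: sum.remove[of UNIV i0])
    then have "of_int (k a i) - x a $ i = (\<Sum>i\<in>UNIV - {i0}. x a $ i - of_int (round (x a $ i)))"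
      using True by (simp add: k_def sum_subtractf)
    also have "\<bar>\<dots>\<bar> \<le> (\<Sum>i\<in>UNIV - {i0}. \<bar>x a $ i - of_int (round (x a $ i))\<bar>)"
      by (rule sum_abs)
    also have "\<dots> \<le> (\<Sum>i\<in>UNIV - {i0}. 1)"
    proof (rule sum_mono)
      fix i
      show "\<bar>x a $ i - of_int (round (x a $ i))\<bar> \<le> 1"
        using of_int_round_abs_le[of "x a $ i"] by linarith
    qed
    also have "\<dots> \<le> (\<Sum>i\<in>(UNIV::'n set). 1)"
      by (rule sum_mono2) auto
    finally show ?thesis
      by simp
  next
    case False
    have "1 \<le> real CARD('n)"
      by (simp add: Suc_leI)
    then have "\<bar>of_int (round (x a $ i)) - x a $ i\<bar> \<le> real CARD('n)"
      using of_int_round_abs_le[of "x a $ i"] by linarith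
    then show ?thesis
      using False by (simp add: k_def)
  qed
  define R where "R = (\<Sum>i\<in>(UNIV::'n set). real CARD('n))"
  have k_near: "k a \<in> near_lattice R \<Gamma>" for a
  proof -
    have "infdist (lattice_point (k a)) \<Gamma> \<le> dist (lattice_point (k a)) (x a)"
      by (rule infdist_le[OF x\<Gamma>])
    also have "\<dots> \<le> (\<Sum>i\<in>UNIV. \<bar>(lattice_point (k a) - x a) $ i\<bar>)"
      unfolding dist_norm by (rule norm_le_l1_cart)
    also have "\<dots> \<le> R"
      unfolding R_def using kx by (intro sum_mono) (simp add: lattice_point_def)
    finally have "infdist (lattice_point (k a)) \<Gamma> \<le> R" .
    moreover have "(\<Sum>j\<in>UNIV. k a j) = 0"
      by (simp add: sum.remove[of UNIV i0] k_def)
    ultimately show ?thesis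
      by (simp add: near_lattice_def)
  qed
  have "2 ^ (u * (d - 1)) \<le> card (near_lattice R \<Gamma> \<inter> rs_box (u + v + 1))" for u
  proof -
    let ?P = "J \<rightarrow>\<^sub>E {0..<2 ^ u} :: ('n \<Rightarrow> int) set"
    have "k a \<in> rs_box (u + v + 1)" if a: "a \<in> ?P" for a
      unfolding mem_rs_box
    proof
      fix i
      have "\<bar>x a $ i\<bar> \<le> (\<Sum>j\<in>J. \<bar>of_int (a j) * w j $ i\<bar>)"
        unfolding x_nth by (rule sum_abs)
      also have "\<dots> \<le> (\<Sum>j\<in>J. 2 ^ u * (\<Sum>i\<in>UNIV. \<bar>w j $ i\<bar>))"
      proof (rule sum_mono)
        fix j assume "j \<in> J"
        then have "a j \<in> {0..<2 ^ u}"
          using a by auto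
        then have "\<bar>real_of_int (a j)\<bar> \<le> real_of_int (2 ^ u)"
          by (simp only: of_int_abs[symmetric] of_int_le_iff) auto
        moreover have "\<bar>w j $ i\<bar> \<le> (\<Sum>i\<in>UNIV. \<bar>w j $ i\<bar>)"
          by (rule member_le_sum) auto
        ultimately show "\<bar>of_int (a j) * w j $ i\<bar> \<le> 2 ^ u * (\<Sum>i\<in>UNIV. \<bar>w j $ i\<bar>)"
          unfolding abs_mult by (intro mult_mono) auto
      qed
      also have "\<dots> = 2 ^ u * E"
        by (simp add: E_def sum_distrib_left)
      also have "\<dots> \<le> 2 ^ u * 2 ^ v"
        using v by (intro mult_left_mono) auto
      finally have "\<bar>real_of_int (k a i)\<bar> < 2 ^ u * 2 ^ v + 2 ^ v"
        using kx[of a i] v by linarith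
      also have "\<dots> \<le> 2 ^ u * 2 ^ v + 2 ^ u * 2 ^ v"
        by simp
      also have "\<dots> = real_of_int (2 ^ (u + v + 1))"
        by (simp add: power_add)
      finally show "\<bar>k a i\<bar> < 2 ^ (u + v + 1)"
        by (simp only: of_int_abs[symmetric] of_int_less_iff)
    qed
    then have sub: "k ` ?P \<subseteq> near_lattice R \<Gamma> \<inter> rs_box (u + v + 1)"
      using k_near by blast
    have inj: "inj_on k ?P"
    proof (rule inj_onI)
      fix a b assume a: "a \<in> ?P" and b: "b \<in> ?P" and eq: "k a = k b"
      have "a i = b i" if i: "i \<in> J" for i
      proof -
        have "k c i = c i" for c
          using i i0 xJ[OF i, of c] by (auto simp: k_def)
        then show ?thesis
          using eq by metis
      qed
      then show "a = b"
        using a b by (intro PiE_ext)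
    qed
    have "2 ^ (u * (d - 1)) = card ?P"
      by (simp add: card_PiE J power_mult nat_power_eq)
    also have "\<dots> = card (k ` ?P)"
      by (rule card_image[OF inj, symmetric])
    also have "\<dots> \<le> card (near_lattice R \<Gamma> \<inter> rs_box (u + v + 1))"
      by (intro card_mono sub finite_Int disjI2 finite_rs_box)
    finally show ?thesis .
  qed
  then show ?thesis
    by blast
qed


subsection \<open>Unboundedness\<close>

lemma rs_symbol_adapted:
  fixes \<Gamma> :: "(real ^ 'n::{finite,linorder}) set"
  assumes "subspace \<Gamma>"
  shows "rs_symbol (near_lattice R \<Gamma>) \<in> adapted_symbols \<Gamma>"
  unfolding rs_symbol_def
proof (rule lattice_symbol_adapted[OF assms abs_rs_symbol_coeff])
  fix k :: "'n \<Rightarrow> int"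
  assume "(if k \<in> near_lattice R \<Gamma> then \<Prod>j\<in>UNIV. rs_coeff (k j) else 0) \<noteq> 0"
  then have "k \<in> near_lattice R \<Gamma>"
    by (auto split: if_splits)
  then show "infdist (\<chi> j. of_int (k j)) \<Gamma> \<le> R"
    by (simp add: near_lattice_def lattice_point_def)
qed

lemma nondegenerate_unbounded_symbol:
  fixes \<Gamma> :: "(real ^ 'n::{finite,linorder}) set"
  assumes nd: "nondegenerate_subspace d \<Gamma>" and d: "CARD('n) + 3 \<le> 2 * d" "d \<le> CARD('n)"
  shows "\<exists>m\<in>adapted_symbols \<Gamma>. satisfies_no_Lp_estimates (multiplier_op m)"
proof -
  let ?n = "CARD('n)"
  have d0: "0 < d"
    using d by simp
  obtain R v where card: "\<And>u. 2 ^ (u * (d - 1)) \<le> card (near_lattice R \<Gamma> \<inter> rs_box (u + v + 1))"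
    using card_near_lattice[OF nd d0 d(2)] by blast
  let ?\<Lambda> = "near_lattice R \<Gamma>"
  let ?T = "multiplier_op (rs_symbol ?\<Lambda>)"
  have \<Lambda>: "\<forall>k\<in>?\<Lambda>. (\<Sum>j\<in>UNIV. k j) = 0"
    by (simp add: near_lattice_def)
  obtain \<delta> where \<delta>: "0 < \<delta>" "\<And>K. \<exists>\<sigma>>0. \<forall>x. \<bar>x\<bar> \<le> \<delta> / \<sigma> \<longrightarrow>
        real (card (?\<Lambda> \<inter> rs_box K)) / 2 - 1 / 4 \<le> norm (?T (\<lambda>_. rs_packet K \<sigma>) x)"
    using rs_symbol_lower_bound[where 'n = 'n] \<Lambda> by blast
  have False if p: "\<And>j. 1 \<le> p j" and est: "satisfies_Lp_estimate ?T p" for p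
  proof -
    obtain C where C: "\<And>K \<sigma> a. 0 < \<sigma> \<Longrightarrow> 0 < a \<Longrightarrow>
        (\<forall>x. \<bar>x\<bar> \<le> \<delta> / \<sigma> \<longrightarrow> a \<le> norm (?T (\<lambda>_. rs_packet K \<sigma>) x)) \<Longrightarrow> a \<le> C * sqrt (2 ^ K) ^ ?n"
      using estimate_rs_packet[OF p est \<delta>(1)] by blast
    \<comment> \<open>The final inequality is squared to remove the square root; \<open>M\<close>
      collects all that does not depend on \<open>u\<close>.\<close>
    define M where "M = (4 * C)\<^sup>2 * 2 ^ ((v + 1) * ?n)"
    have "2 ^ u \<le> M" for u
    proof -
      let ?K = "u + v + 1"
      let ?N = "real (card (?\<Lambda> \<inter> rs_box ?K))"
      have N: "2 ^ (u * (d - 1)) \<le> ?N"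
        using card[of u] by (metis of_nat_le_iff of_nat_numeral of_nat_power)
      have N1: "1 \<le> ?N"
        using order_trans[OF _ N, of 1] by simp
      obtain \<sigma> where "0 < \<sigma>" "\<forall>x. \<bar>x\<bar> \<le> \<delta> / \<sigma> \<longrightarrow> ?N / 2 - 1 / 4 \<le> norm (?T (\<lambda>_. rs_packet ?K \<sigma>) x)"
        using \<delta>(2)[of ?K] by blast
      then have "?N / 2 - 1 / 4 \<le> C * sqrt (2 ^ ?K) ^ ?n"
        using N1 by (intro C[of \<sigma>]) auto
      \<comment> \<open>As \<open>?N\<close> is at least 1, \<open>?N / 2 - 1 / 4\<close> is at
        least \<open>?N / 4\<close>; hence the factor 4.\<close>
      then have "2 ^ (u * (d - 1)) \<le> 4 * C * sqrt (2 ^ ?K) ^ ?n"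
        using N N1 by linarith
      then have "(2 ^ (u * (d - 1)))\<^sup>2 \<le> (4 * C * sqrt (2 ^ ?K) ^ ?n)\<^sup>2"
        by (rule power_mono) simp
      also have "\<dots> = (4 * C)\<^sup>2 * ((sqrt (2 ^ ?K))\<^sup>2) ^ ?n"
        by (simp only: power_mult_distrib power_mult[symmetric] mult.commute)
      also have "(sqrt (2 ^ ?K))\<^sup>2 = 2 ^ ?K"
        by simp
      also have "(4 * C)\<^sup>2 * (2 ^ ?K) ^ ?n = (4 * C)\<^sup>2 * 2 ^ (?K * ?n)"
        by (simp only: power_mult)
      also have "?K * ?n = (v + 1) * ?n + u * ?n"
        by (simp add: algebra_simps)
      also have "(4 * C)\<^sup>2 * 2 ^ ((v + 1) * ?n + u * ?n) = M * 2 ^ (u * ?n)"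
        by (simp only: M_def power_add mult.assoc)
      finally have upper: "2 ^ (u * (d - 1) * 2) \<le> M * 2 ^ (u * ?n)"
        by (simp only: power_mult)
      \<comment> \<open>The dimension condition enters here: \<open>2 * (d - 1)\<close> exceeds
        \<open>n\<close> by at least 1, which leaves a factor \<open>2 ^ u\<close> that no constant
        can bound.\<close>
      have "u + u * ?n \<le> u * (d - 1) * 2"
      proof -
        have "1 + ?n \<le> (d - 1) * 2"
          using d(1) by linarith
        then have "u * (1 + ?n) \<le> u * ((d - 1) * 2)"
          by (rule mult_le_mono2)
        then show ?thesis
          by (simp add: mult.assoc)
      qed
      then have "(2::real) ^ (u + u * ?n) \<le> 2 ^ (u * (d - 1) * 2)"
        by (rule power_increasing) simp
      then have "2 ^ u * 2 ^ (u * ?n) \<le> M * 2 ^ (u * ?n)"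
        using upper unfolding power_add by (rule order_trans)
      then show ?thesis
        by (rule mult_right_le_imp_le) simp
    qed
    moreover obtain u where "M < 2 ^ u"
      using real_arch_pow[of 2 M] by auto
    ultimately show False
      by (meson not_less)
  qed
  then have "satisfies_no_Lp_estimates ?T"
    by (auto simp: satisfies_no_Lp_estimates_def)
  moreover have "rs_symbol ?\<Lambda> \<in> adapted_symbols \<Gamma>"
    using nd by (intro rs_symbol_adapted) (simp add: nondegenerate_subspace_def)
  ultimately show ?thesis
    by blast
qed

theorem theorem7:
  fixes n d :: nat
  assumes "CARD('n::{finite,linorder}) = n"
    and "(real n + 3) / 2 \<le> real d" and "d < n" and "n \<ge> 5"
  shows "\<exists>\<CC> :: (real ^ 'n::{finite,linorder}) set set. uncountable \<CC> \<and>
    (\<forall>\<Gamma>\<in>\<CC>. nondegenerate_subspace d \<Gamma> \<and>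
       (\<exists>m \<in> adapted_symbols \<Gamma>. satisfies_no_Lp_estimates (multiplier_op m)))"
proof (intro exI conjI ballI)
  have "real (n + 3) \<le> real (2 * d)"
    using assms(2) by simp
  then have "n + 3 \<le> 2 * d"
    by (simp only: of_nat_le_iff)
  then have d: "CARD('n) + 3 \<le> 2 * d" "d < CARD('n)" "0 < d"
    using assms by auto
  show "uncountable {\<Gamma> :: (real ^ 'n::{finite,linorder}) set. nondegenerate_subspace d \<Gamma>}"
    by (rule uncountable_nondegenerate_subspaces[OF d(3,2)])
  fix \<Gamma> :: "(real ^ 'n::{finite,linorder}) set"
  assume "\<Gamma> \<in> {\<Gamma>. nondegenerate_subspace d \<Gamma>}"
  then show "nondegenerate_subspace d \<Gamma>"
    and "\<exists>m\<in>adapted_symbols \<Gamma>. satisfies_no_Lp_estimates (multiplier_op m)"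
    using nondegenerate_unbounded_symbol[of d \<Gamma>] d by auto
qed

end
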